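(* There exist constants $0<C,C'<\infty$ such that the following holds. Let $\lambda=(\lambda_1,\dots,\lambda_r)$ be a partition of $n$, let $\alpha=(\alpha_1,\dots,\alpha_r)$ with $\alpha_i=\lambda_i/n$, $H(\alpha)=-\sum_{i=1}^r\alpha_i\log\alpha_i$, $H'(\alpha)=-\sum_{i=2}^r\alpha_i\log\alpha_i$, $M=\lfloor 1/(1-\alpha_1)\rfloor$, and $$\gamma(\alpha)=\frac{M}{M+1}\left[1-C'\,\frac{H(\alpha)-H'(\alpha)}{H(\alpha)}\right].$$ If $f$ is generated by the random model $R(K,\mathcal C)$ with $K\le C\,D_\lambda^{\gamma(\alpha)}$, then with probability $1-o(1)$ as $n\to\infty$ the sparsest-fit algorithm applied to $\hat f(\lambda)$ recovers $f$.
   Context: $\log$ is the natural logarithm. $S_n$ is the symmetric group on $\{1,\dots,n\}$. For a partition $\lambda=(\lambda_1,\dots,\lambda_r)$ of $n$ ($\lambda_1\ge\dots\ge\lambda_r\ge1$), a $\lambda$-partition of $\{1,\dots,n\}$ is an ordered tuple $(B_1,\dots,B_r)$ of disjoint sets with $|B_i|=\lambda_i$ and union $\{1,\dots,n\}$; there are $D_\lambda=n!/\prod_i\lambda_i!$ of them, enumerated $t_1,\dots,t_{D_\lambda}$; $\sigma$ acts by $\sigma(B_1,\dots,B_r)=(\sigma(B_1),\dots,\sigma(B_r))$. $M^\lambda(\sigma)$ is the $D_\lambda\times D_\lambda$ $0/1$ matrix with $M^\lambda_{ij}(\sigma)=1$ iff $\sigma(t_j)=t_i$, and $\hat f(\lambda)=\sum_\sigma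 f(\sigma)M^\lambda(\sigma)$. Random model $R(K,\mathcal C)$: for fixed $\mathcal C=[a,b]$, $0<a<b$, choose $\sigma_1,\dots,\sigma_K$ i.i.d. uniform from $S_n$ (with replacement) and $p_1,\dots,p_K$ i.i.d. uniform on $\mathcal C$; $f(\sigma)=p_i$ if $\sigma=\sigma_i$, else $0$. Sparsest-fit algorithm: input the nonzero entries $q_1\le\dots\le q_L$ of $\hat f(\lambda)$ sorted ascending (with their matrix positions). Initialize $p_0=0$, $k(0)=0$, all $A_k=\emptyset$. For $\ell=1,\dots,L$: if $q_\ell=\sum_{k\in T}p_k$ for some $T\subseteq\{0,\dots,k(\ell-1)\}$, set $k(\ell)=k(\ell-1)$ and add $\ell$ to $A_k$ for $k\in T$; else set $k(\ell)=k(\ell-1)+1$, $p_{k(\ell)}=q_\ell$, add $\ell$ to $A_{k(\ell)}$. Output $(p_k,A_k)_{1\le k\le k(L)}$; each $A_k$ (a set of matrix positions) is read as the support of $M^\lambda(\sigma_k)$, giving a permutation $\sigma_k$ with value $p_k$. "Recovers $f$" means the resulting function equals $f$. *)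

theory Defs
  imports "HOL-Probability.Probability" "HOL-Combinatorics.Permutations"
begin

definition is_partition :: "nat list \<Rightarrow> nat \<Rightarrow> bool" where
  "is_partition lam n \<longleftrightarrow> sorted_wrt (\<ge>) lam \<and> (\<forall>x\<in>set lam. 0 < x) \<and> sum_list lam = n"

definition Sn :: "nat \<Rightarrow> (nat \<Rightarrow> nat) set" where
  "Sn n = {\<sigma>. \<sigma> permutes {1..n}}"

definition lam_parts :: "nat list \<Rightarrow> nat \<Rightarrow> nat set list set" where
  "lam_parts lam n = {Bs. length Bs = length lam
     \<and> (\<forall>i<length lam. card (Bs ! i) = lam ! i)
     \<and> (\<forall>i<length lam. \<forall>j<length lam. i \<noteq> j \<longrightarrow> Bs ! i \<inter> Bs ! j = {})
     \<and> \<Union>(set Bs) = {1..n}}"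

definition D_lam :: "nat list \<Rightarrow> nat \<Rightarrow> real" where
  "D_lam lam n = fact n / (\<Prod>i<length lam. fact (lam ! i))"

definition act :: "(nat \<Rightarrow> nat) \<Rightarrow> nat set list \<Rightarrow> nat set list" where
  "act \<sigma> Bs = map (\<lambda>B. \<sigma> ` B) Bs"

(* matrix positions (t_i, t_j) are indexed by the lambda-partitions themselves *)
type_synonym pos = "nat set list \<times> nat set list"

definition Mlam :: "(nat \<Rightarrow> nat) \<Rightarrow> pos \<Rightarrow> real" where
  "Mlam \<sigma> ts = (if act \<sigma> (snd ts) = fst ts then 1 else 0)"

definition positions :: "nat list \<Rightarrow> nat \<Rightarrow> pos set" where
  "positions lam n = lam_parts lam n \<times> lam_parts lam n"

definition fhat :: "nat list \<Rightarrow> nat \<Rightarrow> ((nat \<Rightarrow> nat) \<Rightarrow> real) \<Rightarrow> pos \<Rightarrow> real" where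
  "fhat lam n f ts = (\<Sum>\<sigma>\<in>Sn n. f \<sigma> * Mlam \<sigma> ts)"

definition supp_M :: "nat list \<Rightarrow> nat \<Rightarrow> (nat \<Rightarrow> nat) \<Rightarrow> pos set" where
  "supp_M lam n \<sigma> = {ts \<in> positions lam n. Mlam \<sigma> ts = 1}"

type_synonym sf_state = "nat \<times> (nat \<Rightarrow> real) \<times> (nat \<Rightarrow> pos set)"

(* one step of the algorithm, processing entry x with value q x;
   nondeterministic in the choice of T, so all choices are returned *)
definition sf_step :: "(pos \<Rightarrow> real) \<Rightarrow> pos \<Rightarrow> sf_state \<Rightarrow> sf_state set" where
  "sf_step q x st = (case st of (k, p, A) \<Rightarrow>
     if \<exists>T. T \<subseteq> {0..k} \<and> q x = (\<Sum>i\<in>T. p i)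
     then {(k, p, \<lambda>i. if i \<in> T then insert x (A i) else A i) | T. T \<subseteq> {0..k} \<and> q x = (\<Sum>i\<in>T. p i)}
     else {(Suc k, p(Suc k := q x), A(Suc k := insert x (A (Suc k))))})"

primrec sf_runs :: "(pos \<Rightarrow> real) \<Rightarrow> pos list \<Rightarrow> sf_state \<Rightarrow> sf_state set" where
  "sf_runs q [] st = {st}"
| "sf_runs q (x # xs) st = (\<Union>st'\<in>sf_step q x st. sf_runs q xs st')"

definition sf_init :: sf_state where
  "sf_init = (0, \<lambda>_. 0, \<lambda>_. {})"

definition sparsest_fit_recovers :: "nat list \<Rightarrow> nat \<Rightarrow> ((nat \<Rightarrow> nat) \<Rightarrow> real) \<Rightarrow> bool" where
  "sparsest_fit_recovers lam n f \<longleftrightarrow>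
    (let q = fhat lam n f in
     \<forall>ps. distinct ps \<and> set ps = {ts \<in> positions lam n. q ts \<noteq> 0}
          \<and> sorted_wrt (\<lambda>x y. q x \<le> q y) ps \<longrightarrow>
       (\<forall>(k, p, A) \<in> sf_runs q ps sf_init.
          \<exists>\<sigma>s. (\<forall>j\<in>{1..k}. \<sigma>s j \<in> Sn n \<and> A j = supp_M lam n (\<sigma>s j)
                    \<and> (\<forall>\<tau>\<in>Sn n. supp_M lam n \<tau> = A j \<longrightarrow> \<tau> = \<sigma>s j))
              \<and> inj_on \<sigma>s {1..k}
              \<and> (\<forall>\<tau>\<in>Sn n. f \<tau> = (\<Sum>j\<in>{1..k}. if \<tau> = \<sigma>s j then p j else 0))))"

(* random model R(K,[a,b]): omega i = (sigma_(i+1), p_(i+1)), i < K, all independent,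
   sigma uniform on S_n, p uniform on [a,b] *)
definition model_R :: "nat \<Rightarrow> nat \<Rightarrow> real \<Rightarrow> real \<Rightarrow> (nat \<Rightarrow> (nat \<Rightarrow> nat) \<times> real) measure" where
  "model_R n K a b = PiM {..<K} (\<lambda>_. measure_pmf (pmf_of_set (Sn n)) \<Otimes>\<^sub>M uniform_measure lborel {a..b})"

definition model_f :: "nat \<Rightarrow> (nat \<Rightarrow> (nat \<Rightarrow> nat) \<times> real) \<Rightarrow> (nat \<Rightarrow> nat) \<Rightarrow> real" where
  "model_f K \<omega> \<tau> = (\<Sum>i<K. if fst (\<omega> i) = \<tau> then snd (\<omega> i) else 0)"

(* alpha_i (0-indexed: alpha_i = lambda_(i+1)/n), entropies, M, gamma *)
definition alpha :: "nat list \<Rightarrow> nat \<Rightarrow> nat \<Rightarrow> real" where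
  "alpha lam n i = real (lam ! i) / real n"

definition H_ent :: "nat list \<Rightarrow> nat \<Rightarrow> real" where
  "H_ent lam n = - (\<Sum>i<length lam. alpha lam n i * ln (alpha lam n i))"

definition H'_ent :: "nat list \<Rightarrow> nat \<Rightarrow> real" where
  "H'_ent lam n = - (\<Sum>i\<in>{1..<length lam}. alpha lam n i * ln (alpha lam n i))"

definition M_lam :: "nat list \<Rightarrow> nat \<Rightarrow> int" where
  "M_lam lam n = \<lfloor>1 / (1 - alpha lam n 0)\<rfloor>"

definition gamma_lam :: "real \<Rightarrow> nat list \<Rightarrow> nat \<Rightarrow> real" where
  "gamma_lam C' lam n = real_of_int (M_lam lam n) / (real_of_int (M_lam lam n) + 1)
     * (1 - C' * (H_ent lam n - H'_ent lam n) / H_ent lam n)"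

end

theory Submission
  imports Defs
begin

text \<open>Recovery is deterministic once the values have distinct subset sums, which holds almost surely,
  and every permutation has a witness, i.e. a \<open>\<lambda>\<close>-partition on which it acts differently from all the
  others: the ascending scan then meets every value alone before it meets it inside a larger sum.

  Let \<open>d = n - \<lambda>\<^sub>1\<close>. There is room for \<open>M = n div d\<close> test partitions whose non-largest blocks lie in
  pairwise disjoint windows of length \<open>d\<close>. A random permutation fixes \<open>j\<close> of them with probability at
  most \<open>\<rho>\<^sup>j\<close>, where \<open>\<rho>\<close> is \<open>1 / D\<close> if \<open>M = 1\<close> and at most \<open>e\<^sup>d / D\<close> otherwise. The union bound over
  the ways of spoiling all \<open>M\<close> test partitions bounds the failure probability by \<open>K\<^bsup>M+1\<^esup> \<rho>\<^sup>M\<close>. As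
  \<open>log D \<ge> n H / 12\<close>, the correction term in \<open>\<gamma>\<close> absorbs the excess \<open>e\<^bsup>dM\<^esup> \<le> e\<^sup>n\<close>.\<close>

section \<open>Correctness of the algorithm\<close>

text \<open>\<open>Y\<close> holds the entries scanned so far, \<open>S x\<close> the indices
  contributing to entry \<open>x\<close>, and \<open>g j\<close> the index discovered as the
  \<open>j\<close>-th value. The discovered indices are exactly those with a scanned witness, an
  entry with \<open>S x = {i}\<close>.\<close>

definition sf_invar ::
  "(pos \<Rightarrow> nat set) \<Rightarrow> (nat \<Rightarrow> real) \<Rightarrow> pos set \<Rightarrow> (nat \<Rightarrow> nat) \<Rightarrow> sf_state \<Rightarrow> bool" where
  "sf_invar S v Y g st = (case st of (k, p, A) \<Rightarrow>
     bij_betw g {1..k} {i. \<exists>x\<in>Y. S x = {i}} \<and> p 0 = 0 \<and> (\<forall>j\<in>{1..k}. p j = v (g j)) \<and>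
     (\<forall>j\<in>{1..k}. A j = {x\<in>Y. g j \<in> S x}) \<and> (\<forall>j>k. A j = {}))"

text \<open>The scan stripped of permutations: entries are subset sums of the values
  \<open>v\<close>, and \<open>sums_inj\<close> lets the value of an entry determine its index
  set.\<close>

locale witnessed_sums =
  fixes K :: nat and v :: "nat \<Rightarrow> real" and S :: "pos \<Rightarrow> nat set" and q :: "pos \<Rightarrow> real"
    and ps :: "pos list"
  assumes v_pos: "i < K \<Longrightarrow> 0 < v i"
    and sums_inj: "inj_on (sum v) (Pow {..<K})"
    and S_sub: "x \<in> set ps \<Longrightarrow> S x \<subseteq> {..<K}"
    and q_eq: "x \<in> set ps \<Longrightarrow> q x = sum v (S x)"
    and witness: "i < K \<Longrightarrow> \<exists>x\<in>set ps. S x = {i}"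
    and sorted: "sorted_wrt (\<lambda>x y. q x \<le> q y) ps"
begin

lemma sum_v_less:
  assumes "i \<in> A" "A \<subseteq> {..<K}" "A \<noteq> {i}"
  shows "v i < sum v A"
proof -
  have fin: "finite A" using assms(2) finite_subset by blast
  have "sum v A = v i + sum v (A - {i})" using fin assms(1) by (simp add: sum.remove)
  moreover have "0 < sum v (A - {i})"
    by (rule sum_pos) (use fin assms v_pos in auto)
  ultimately show ?thesis by simp
qed

text \<open>If all of \<open>S x\<close> is discovered, distinctness of subset sums leaves only one
  choice of \<open>T\<close> up to index 0. Otherwise \<open>x\<close> is itself the witness of an
  undiscovered index, no \<open>T\<close> fits, and a new value is opened.\<close>

lemma sf_step_invar:
  assumes ps: "ps = ys @ x # zs" and inv: "sf_invar S v (set ys) g st" and st': "st' \<in> sf_step q x st"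
  shows "\<exists>g'. sf_invar S v (set (ys @ [x])) g' st'"
proof -
  obtain k p A where st: "st = (k, p, A)" by (cases st)
  define I where "I = {i. \<exists>x\<in>set ys. S x = {i}}"
  have bij: "bij_betw g {1..k} I" and p0: "p 0 = 0" and pj: "\<And>j. j \<in> {1..k} \<Longrightarrow> p j = v (g j)"
    and Aj: "\<And>j. j \<in> {1..k} \<Longrightarrow> A j = {x\<in>set ys. g j \<in> S x}" and Ak: "\<And>j. j > k \<Longrightarrow> A j = {}"
    using inv unfolding sf_invar_def st I_def by auto
  have xps: "x \<in> set ps" and ysps: "set ys \<subseteq> set ps" using ps by auto
  have IK: "I \<subseteq> {..<K}" using S_sub ysps by (fastforce simp: I_def)
  have qle: "q y \<le> q x" if "y \<in> set ys" for y using sorted that unfolding ps by (auto simp: sorted_wrt_append)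
  have qge: "q x \<le> q y" if "y \<in> set (x # zs)" for y using sorted that unfolding ps by (auto simp: sorted_wrt_append)
  \<comment> \<open>Since \<open>p 0 = 0\<close>, index 0 may or may not belong to \<open>T\<close>;
    deleting it leaves a sum of \<open>v\<close> over discovered indices.\<close>
  have sumT: "(\<Sum>i\<in>T. p i) = sum v (g ` (T - {0}))" if T: "T \<subseteq> {0..k}" for T
  proof -
    have fin: "finite T" using T finite_subset by blast
    have T1: "T - {0} \<subseteq> {1..k}" using T by fastforce
    have "sum p T = sum p (T - {0})" by (rule sum.mono_neutral_right) (use fin p0 in auto)
    also have "\<dots> = (\<Sum>j\<in>T-{0}. v (g j))" by (rule sum.cong) (use T1 pj in auto)
    also have "\<dots> = sum v (g ` (T - {0}))"
      by (rule sum.reindex_cong[symmetric, of g])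
         (use bij T1 in \<open>auto simp: bij_betw_def intro: inj_on_subset\<close>)
    finally show ?thesis .
  qed
  have gI: "g ` (T - {0}) \<subseteq> I" if "T \<subseteq> {0..k}" for T
    using bij that by (fastforce simp: bij_betw_def)
  have Teq: "g ` (T - {0}) = S x" if T: "T \<subseteq> {0..k}" and eq: "q x = (\<Sum>i\<in>T. p i)" for T
  proof -
    have "sum v (g ` (T - {0})) = sum v (S x)" using eq sumT[OF T] q_eq[OF xps] by simp
    moreover have "g ` (T - {0}) \<in> Pow {..<K}" "S x \<in> Pow {..<K}"
      using gI[OF T] IK S_sub[OF xps] by auto
    ultimately show ?thesis by (rule inj_onD[OF sums_inj])
  qed
  \<comment> \<open>By positivity the witness of \<open>i\<close> is strictly smaller than any other
    entry containing \<open>i\<close>, so the ascending scan has already passed it.\<close>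
  have Isub: "i \<in> I" if i: "i \<in> S x" "S x \<noteq> {i}" for i
  proof -
    have "i < K" using i S_sub[OF xps] by auto
    then obtain w where w: "w \<in> set ps" "S w = {i}" using witness by blast
    have "q w < q x" using q_eq[OF w(1)] q_eq[OF xps] w(2) sum_v_less[OF i(1) S_sub[OF xps] i(2)] by simp
    then have "w \<notin> set (x # zs)" using qge by fastforce
    then show ?thesis using w ps by (auto simp: I_def)
  qed
  show ?thesis
  proof (cases "S x \<subseteq> I")
    case True
    define T0 where "T0 = {j\<in>{1..k}. g j \<in> S x}"
    have "g ` T0 = S x" using bij True by (auto simp: T0_def bij_betw_def)
    moreover have T0: "T0 \<subseteq> {0..k}" "T0 - {0} = T0" by (auto simp: T0_def)
    ultimately have "q x = sum p T0" using sumT[OF T0(1)] q_eq[OF xps] by simp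
    then have "\<exists>T. T \<subseteq> {0..k} \<and> q x = (\<Sum>i\<in>T. p i)" using T0(1) by blast
    then obtain T where T: "T \<subseteq> {0..k}" "q x = (\<Sum>i\<in>T. p i)"
      and st'eq: "st' = (k, p, \<lambda>i. if i \<in> T then insert x (A i) else A i)"
      using st' unfolding st sf_step_def by auto
    have mem: "j \<in> T \<longleftrightarrow> g j \<in> S x" if "j \<in> {1..k}" for j
    proof -
      have inj: "inj_on g {1..k}" using bij by (simp add: bij_betw_def)
      have "T - {0} \<subseteq> {1..k}" using T(1) by fastforce
      then have "g j \<in> g ` (T - {0}) \<longleftrightarrow> j \<in> T - {0}" using inj_on_image_mem_iff[OF inj that] by blast
      then show ?thesis using Teq[OF T] that by auto
    qed
    have "{i. \<exists>y\<in>set (ys @ [x]). S y = {i}} = I" using True by (auto simp: I_def)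
    moreover have "j \<notin> T" if "j > k" for j using T(1) that by auto
    ultimately have "sf_invar S v (set (ys @ [x])) g st'"
      unfolding st'eq sf_invar_def using bij p0 pj Aj Ak mem by auto
    then show ?thesis by blast
  next
    case False
    then obtain i where i: "i \<in> S x" "i \<notin> I" by blast
    then have Sx: "S x = {i}" using Isub by blast
    have nex: "\<not> (\<exists>T. T \<subseteq> {0..k} \<and> q x = (\<Sum>i\<in>T. p i))" using Teq gI False by metis
    have st'eq: "st' = (Suc k, p(Suc k := q x), A(Suc k := insert x (A (Suc k))))"
      using st' unfolding st sf_step_def prod.case if_not_P[OF nex] by blast
    define g' where "g' = g(Suc k := i)"
    have g': "g' j = g j" if "j \<in> {1..k}" for j using that by (auto simp: g'_def)
    have ivl: "{1..Suc k} = insert (Suc k) {1..k}" by auto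
    have "bij_betw g' {1..k} I" using bij bij_betw_cong[of "{1..k}" g' g I] g' by blast
    then have "bij_betw g' (insert (Suc k) {1..k}) (insert (g' (Suc k)) I)"
      using notIn_Un_bij_betw[of "Suc k" "{1..k}" g' I] i by (simp add: g'_def)
    moreover have "insert (g' (Suc k)) I = {i. \<exists>y\<in>set (ys @ [x]). S y = {i}}"
      using Sx by (auto simp: I_def g'_def)
    ultimately have bij': "bij_betw g' {1..Suc k} {i. \<exists>y\<in>set (ys @ [x]). S y = {i}}"
      using ivl by simp
    \<comment> \<open>The set opened for \<open>i\<close> contains only \<open>x\<close>, so no
      scanned entry may contain \<open>i\<close>. Such an entry would be at most \<open>v i\<close>,
      hence a witness of \<open>i\<close>, which is undiscovered.\<close>
    have none: "i \<notin> S y" if y: "y \<in> set ys" for y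
    proof
      assume iy: "i \<in> S y"
      have "q y \<le> v i" using qle[OF y] q_eq[OF xps] Sx by simp
      then have "sum v (S y) \<le> v i" using q_eq[of y] y ysps by auto
      then have "S y = {i}" using sum_v_less[OF iy] S_sub y ysps by fastforce
      then show False using i y by (auto simp: I_def)
    qed
    have gx: "g j \<noteq> i" if "j \<in> {1..k}" for j using bij that i by (auto simp: bij_betw_def)
    have "sf_invar S v (set (ys @ [x])) g' st'"
      unfolding st'eq sf_invar_def using bij' p0 pj Aj Ak g' Sx none gx q_eq[OF xps]
      by (auto simp: ivl g'_def)
    then show ?thesis by blast
  qed
qed

lemma sf_runs_invar:
  assumes "ps = ys @ zs" "sf_invar S v (set ys) g st" "st' \<in> sf_runs q zs st"
  shows "\<exists>g'. sf_invar S v (set ps) g' st'"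
  using assms
proof (induction zs arbitrary: ys g st)
  case (Cons x zs)
  then obtain st1 where st1: "st1 \<in> sf_step q x st" "st' \<in> sf_runs q zs st1" by auto
  obtain g1 where "sf_invar S v (set (ys @ [x])) g1 st1"
    using sf_step_invar[OF Cons.prems(1,2) st1(1)] by blast
  then show ?case using Cons.IH[of "ys @ [x]" g1 st1] Cons.prems(1) st1(2) by simp
qed auto

lemma sf_runs_result:
  assumes "(k, p, A) \<in> sf_runs q ps sf_init"
  shows "\<exists>g. bij_betw g {1..k} {..<K} \<and>
    (\<forall>j\<in>{1..k}. p j = v (g j) \<and> A j = {x\<in>set ps. g j \<in> S x})"
proof -
  have "sf_invar S v (set []) (\<lambda>_. 0) sf_init"
    by (simp add: sf_invar_def sf_init_def bij_betw_def)
  from sf_runs_invar[OF _ this assms] obtain g where g: "sf_invar S v (set ps) g (k, p, A)" by auto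
  have "{i. \<exists>x\<in>set ps. S x = {i}} = {..<K}" using witness S_sub by fastforce
  then show ?thesis using g unfolding sf_invar_def by auto
qed

end

section \<open>From matrix entries to subset sums\<close>

lemma finite_Sn [simp]: "finite (Sn n)"
  unfolding Sn_def by (rule finite_permutations) simp

lemma Mlam_mem_supp_M: "ts \<in> positions lam n \<Longrightarrow> Mlam \<sigma> ts = (if ts \<in> supp_M lam n \<sigma> then 1 else 0)"
  by (simp add: supp_M_def Mlam_def)

text \<open>Exchange the sums over permutations and samples. The result is indexed by samples, so
  coinciding permutations simply add their values.\<close>

lemma fhat_model_f:
  assumes "\<And>i. i < K \<Longrightarrow> fst (\<omega> i) \<in> Sn n" "ts \<in> positions lam n"
  shows "fhat lam n (model_f K \<omega>) ts
    = sum (\<lambda>i. snd (\<omega> i)) {i\<in>{..<K}. ts \<in> supp_M lam n (fst (\<omega> i))}"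
proof -
  have "fhat lam n (model_f K \<omega>) ts
    = (\<Sum>\<sigma>\<in>Sn n. \<Sum>i<K. (if fst (\<omega> i) = \<sigma> then snd (\<omega> i) * Mlam \<sigma> ts else 0))"
    unfolding fhat_def model_f_def by (simp add: sum_distrib_right if_distrib[of "\<lambda>x. x * _"] cong: if_cong)
  also have "\<dots> = (\<Sum>i<K. \<Sum>\<sigma>\<in>Sn n. (if fst (\<omega> i) = \<sigma> then snd (\<omega> i) * Mlam \<sigma> ts else 0))"
    by (rule sum.swap)
  also have "\<dots> = (\<Sum>i<K. snd (\<omega> i) * Mlam (fst (\<omega> i)) ts)"
    using assms(1) by (intro sum.cong) (auto simp: sum.delta')
  also have "\<dots> = (\<Sum>i<K. if ts \<in> supp_M lam n (fst (\<omega> i)) then snd (\<omega> i) else 0)"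
    using Mlam_mem_supp_M[OF assms(2)] by (intro sum.cong) auto
  also have "\<dots> = sum (\<lambda>i. snd (\<omega> i)) {i\<in>{..<K}. ts \<in> supp_M lam n (fst (\<omega> i))}"
    by (subst sum.inter_filter) auto
  finally show ?thesis .
qed

text \<open>The abstract scan applies with \<open>S x\<close> the samples whose support contains
  position \<open>x\<close>; \<open>faithful\<close> makes the permutation read off from each
  \<open>A j\<close> unique.\<close>

lemma sparsest_fit_recovers_if_witnessed:
  assumes Sn: "\<And>i. i < K \<Longrightarrow> fst (\<omega> i) \<in> Sn n"
    and pos: "\<And>i. i < K \<Longrightarrow> 0 < snd (\<omega> i)"
    and inj: "inj_on (sum (\<lambda>i. snd (\<omega> i))) (Pow {..<K})"
    and wit: "\<And>i. i < K \<Longrightarrow> \<exists>x. {j\<in>{..<K}. x \<in> supp_M lam n (fst (\<omega> j))} = {i}"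
    and faithful: "\<And>i \<tau>. i < K \<Longrightarrow> \<tau> \<in> Sn n \<Longrightarrow> supp_M lam n \<tau> = supp_M lam n (fst (\<omega> i)) \<Longrightarrow> \<tau> = fst (\<omega> i)"
  shows "sparsest_fit_recovers lam n (model_f K \<omega>)"
  unfolding sparsest_fit_recovers_def Let_def
proof (intro allI impI ballI, clarify)
  fix ps k p A
  let ?q = "fhat lam n (model_f K \<omega>)"
  let ?S = "\<lambda>x. {i\<in>{..<K}. x \<in> supp_M lam n (fst (\<omega> i))}"
  let ?v = "\<lambda>i. snd (\<omega> i)"
  assume ps: "distinct ps" "set ps = {ts \<in> positions lam n. ?q ts \<noteq> 0}"
    "sorted_wrt (\<lambda>x y. ?q x \<le> ?q y) ps" and run: "(k, p, A) \<in> sf_runs ?q ps sf_init"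
  have supp_pos: "supp_M lam n \<sigma> \<subseteq> positions lam n" for \<sigma> by (auto simp: supp_M_def)
  \<comment> \<open>Positive values cannot cancel, so every position in some support has a nonzero
    entry and is listed in \<open>ps\<close>.\<close>
  have supp_ps: "x \<in> set ps" if i: "i < K" and x: "x \<in> supp_M lam n (fst (\<omega> i))" for i x
  proof -
    have "x \<in> positions lam n" using x supp_pos by blast
    moreover have "0 < sum ?v (?S x)" by (rule sum_pos) (use i x pos in auto)
    ultimately show ?thesis using ps(2) fhat_model_f[of K \<omega> n x lam] Sn by auto
  qed
  interpret witnessed_sums K ?v ?S ?q ps
  proof
    show "\<exists>x\<in>set ps. ?S x = {i}" if i: "i < K" for i
    proof -
      obtain x where x: "?S x = {i}" using wit[OF i] by blast
      then have "x \<in> supp_M lam n (fst (\<omega> i))" by blast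
      then show ?thesis using supp_ps[OF i] x by blast
    qed
  qed (use pos inj ps fhat_model_f[of K \<omega> n _ lam] Sn in auto)
  obtain g where bij: "bij_betw g {1..k} {..<K}"
    and g: "\<And>j. j \<in> {1..k} \<Longrightarrow> p j = ?v (g j) \<and> A j = {x\<in>set ps. g j \<in> ?S x}"
    using sf_runs_result[OF run] by blast
  define \<sigma>s where "\<sigma>s = (\<lambda>j. fst (\<omega> (g j)))"
  have gK: "g j < K" if "j \<in> {1..k}" for j using bij that by (auto simp: bij_betw_def)
  have A: "A j = supp_M lam n (\<sigma>s j)" if j: "j \<in> {1..k}" for j
    using g[OF j] supp_ps gK[OF j] by (auto simp: \<sigma>s_def)
  \<comment> \<open>A witness of \<open>i\<close> lies in the support of no other sample, so no
    other sample carries the same permutation.\<close>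
  have fst_inj: "i = j" if ij: "i < K" "j < K" "fst (\<omega> i) = fst (\<omega> j)" for i j
  proof -
    obtain x where x: "?S x = {i}" using wit[OF ij(1)] by blast
    then have "x \<in> supp_M lam n (fst (\<omega> i))" by blast
    then have "j \<in> ?S x" using ij by auto
    then have "j \<in> {i}" unfolding x .
    then show ?thesis by simp
  qed
  have "inj_on \<sigma>s {1..k}"
  proof (rule inj_onI)
    fix i j assume ij: "i \<in> {1..k}" "j \<in> {1..k}" "\<sigma>s i = \<sigma>s j"
    then have "g i = g j" using fst_inj[OF gK gK] by (simp add: \<sigma>s_def)
    then show "i = j" using inj_onD[OF bij_betw_imp_inj_on[OF bij]] ij by blast
  qed
  moreover have "model_f K \<omega> \<tau> = (\<Sum>j\<in>{1..k}. if \<tau> = \<sigma>s j then p j else 0)" for \<tau>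
  proof -
    have "model_f K \<omega> \<tau> = (\<Sum>j\<in>{1..k}. if fst (\<omega> (g j)) = \<tau> then snd (\<omega> (g j)) else 0)"
      unfolding model_f_def by (rule sum.reindex_bij_betw[OF bij, symmetric])
    also have "\<dots> = (\<Sum>j\<in>{1..k}. if \<tau> = \<sigma>s j then p j else 0)"
      by (rule sum.cong[OF refl]) (simp only: g \<sigma>s_def eq_commute[of \<tau>])
    finally show ?thesis .
  qed
  ultimately show "\<exists>\<sigma>s. (\<forall>j\<in>{1..k}. \<sigma>s j \<in> Sn n \<and> A j = supp_M lam n (\<sigma>s j)
                    \<and> (\<forall>\<tau>\<in>Sn n. supp_M lam n \<tau> = A j \<longrightarrow> \<tau> = \<sigma>s j))
              \<and> inj_on \<sigma>s {1..k}
              \<and> (\<forall>\<tau>\<in>Sn n. model_f K \<omega> \<tau> = (\<Sum>j\<in>{1..k}. if \<tau> = \<sigma>s j then p j else 0))"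
    using A Sn gK faithful unfolding \<sigma>s_def by (intro exI[of _ "\<lambda>j. fst (\<omega> (g j))"] conjI ballI impI) simp_all
qed

section \<open>The action on \<open>\<lambda>\<close>-partitions\<close>

lemma act_comp: "act (f \<circ> g) Bs = act f (act g Bs)"
  by (simp add: act_def image_comp)

lemma act_inv_cancel: "\<sigma> \<in> Sn n \<Longrightarrow> act (inv \<sigma>) (act \<sigma> Bs) = Bs"
  unfolding Sn_def mem_Collect_eq act_comp[symmetric] permutes_inv_o by (simp add: act_def)

lemma act_mem_lam_parts:
  assumes "\<sigma> \<in> Sn n" "t \<in> lam_parts lam n"
  shows "act \<sigma> t \<in> lam_parts lam n"
proof -
  have perm: "\<sigma> permutes {1..n}" using assms(1) by (simp add: Sn_def)
  have inj: "inj \<sigma>" using perm by (rule permutes_inj)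
  have "\<Union>(set (act \<sigma> t)) = \<sigma> ` \<Union>(set t)" by (auto simp: act_def)
  also have "\<dots> = {1..n}" using assms(2) permutes_image[OF perm] by (simp add: lam_parts_def)
  finally have "\<Union>(set (act \<sigma> t)) = {1..n}" .
  then show ?thesis using assms(2) inj
    by (auto simp: lam_parts_def act_def card_image inj_on_subset image_Int[symmetric])
qed

lemma mem_supp_M_iff:
  assumes "\<sigma> \<in> Sn n"
  shows "x \<in> supp_M lam n \<sigma> \<longleftrightarrow> snd x \<in> lam_parts lam n \<and> fst x = act \<sigma> (snd x)"
  using act_mem_lam_parts[OF assms]
  by (cases x) (auto simp: supp_M_def positions_def Mlam_def split: if_splits)

section \<open>Test partitions built from consecutive intervals\<close>

fun blocks :: "nat \<Rightarrow> nat list \<Rightarrow> nat set list" where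
  "blocks s [] = []"
| "blocks s (x # xs) = {s<..s + x} # blocks (s + x) xs"

lemma length_blocks [simp]: "length (blocks s xs) = length xs"
  by (induction xs arbitrary: s) auto

lemma card_blocks [simp]: "i < length xs \<Longrightarrow> card (blocks s xs ! i) = xs ! i"
  by (induction xs arbitrary: s i) (auto simp: nth_Cons split: nat.splits)

lemma Union_blocks: "\<Union>(set (blocks s xs)) = {s<..s + sum_list xs}"
  by (induction xs arbitrary: s) auto

lemma blocks_nth_subset: "i < length xs \<Longrightarrow> blocks s xs ! i \<subseteq> {s<..s + sum_list xs}"
  using Union_blocks[of s xs] by (metis Union_upper length_blocks nth_mem)

lemma blocks_disjoint:
  "i < length xs \<Longrightarrow> j < length xs \<Longrightarrow> i \<noteq> j \<Longrightarrow> blocks s xs ! i \<inter> blocks s xs ! j = {}"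
proof (induction xs arbitrary: s i j)
  case (Cons x xs)
  show ?case
  proof (cases i)
    case 0
    with Cons.prems obtain j' where j: "j = Suc j'" "j' < length xs" by (cases j) auto
    with 0 show ?thesis using blocks_nth_subset[OF j(2), of "s + x"] by fastforce
  next
    case (Suc i')
    show ?thesis
    proof (cases j)
      case 0
      with Suc Cons.prems show ?thesis using blocks_nth_subset[of i' xs "s + x"] by fastforce
    next
      case (Suc j')
      with \<open>i = Suc i'\<close> Cons show ?thesis by simp
    qed
  qed
qed simp

text \<open>The \<open>m\<close>-th partition packs all blocks but the largest into the \<open>m\<close>-th of the consecutive
  windows of length \<open>n - \<lambda>\<^sub>1\<close>, so that different \<open>m\<close> impose conditions on disjoint sets of points.\<close>

definition window :: "nat list \<Rightarrow> nat \<Rightarrow> nat set" where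
  "window ls m = {m * sum_list ls<..m * sum_list ls + sum_list ls}"

definition window_part :: "nat list \<Rightarrow> nat \<Rightarrow> nat \<Rightarrow> nat set list" where
  "window_part ls n m = ({1..n} - window ls m) # blocks (m * sum_list ls) ls"

lemma card_window [simp]: "card (window ls m) = sum_list ls"
  by (simp add: window_def)

lemma finite_window [simp]: "finite (window ls m)"
  by (simp add: window_def)

lemma window_subset:
  assumes "Suc m * sum_list ls \<le> n"
  shows "window ls m \<subseteq> {1..n}"
  using assms by (auto simp: window_def)

lemma windows_disjoint:
  assumes "m \<noteq> m'"
  shows "window ls m \<inter> window ls m' = {}"
proof -
  have *: "window ls m \<inter> window ls m' = {}" if "m < m'" for m m'
  proof -
    have "Suc m * sum_list ls \<le> m' * sum_list ls" using that by (intro mult_le_mono1) simp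
    then show ?thesis by (auto simp: window_def)
  qed
  show ?thesis using *[of m m'] *[of m' m] assms by (cases "m < m'") auto
qed

lemma window_part_mem:
  assumes part: "is_partition (l # ls) n" and m: "Suc m * sum_list ls \<le> n"
  shows "window_part ls n m \<in> lam_parts (l # ls) n"
proof -
  have n: "n = l + sum_list ls" using part by (simp add: is_partition_def)
  have U: "\<Union>(set (blocks (m * sum_list ls) ls)) = window ls m"
    by (simp add: Union_blocks window_def)
  have sub: "blocks (m * sum_list ls) ls ! i \<subseteq> window ls m" if "i < length ls" for i
    using blocks_nth_subset[OF that] by (simp add: window_def)
  have "card ({1..n} - window ls m) = l"
    using window_subset[OF m] n by (subst card_Diff_subset) auto
  then show ?thesis
    using sub window_subset[OF m] unfolding lam_parts_def window_part_def
    by (auto simp: U nth_Cons blocks_disjoint split: nat.splits)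
qed

lemma ex_permutes_two_points:
  assumes "u \<in> A" "w \<in> A" "x \<in> A" "y \<in> A" "u \<noteq> w" "x \<noteq> y"
  shows "\<exists>\<rho>. \<rho> permutes A \<and> \<rho> u = x \<and> \<rho> w = y"
proof -
  \<comment> \<open>The first swap sends \<open>u\<close> to \<open>x\<close> and \<open>w\<close>
    to a point other than \<open>x\<close>, so the second swap can send that point to
    \<open>y\<close> without moving \<open>x\<close>.\<close>
  let ?w = "Transposition.transpose u x w"
  let ?\<rho> = "Transposition.transpose ?w y \<circ> Transposition.transpose u x"
  have "?w \<in> A" "?w \<noteq> x" using assms by (auto simp: Transposition.transpose_def)
  then have "?\<rho> permutes A" using assms by (intro permutes_compose permutes_swap_id)
  moreover have "?\<rho> u = x" "?\<rho> w = y" using assms \<open>?w \<noteq> x\<close> by auto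
  ultimately show ?thesis by blast
qed

text \<open>If \<open>\<tau> x \<noteq> \<sigma> x\<close>, let
  \<open>\<tau> y = \<sigma> x\<close>. A partition with \<open>x\<close> in block 0 and
  \<open>y\<close> in block 1 has different images: this common point lies in block 0 of the image
  under \<sigma> and in block 1 of the image under \<tau>.\<close>

lemma supp_M_inj:
  assumes part: "is_partition (l # ls) n" and ls: "ls \<noteq> []"
    and Sn: "\<sigma> \<in> Sn n" "\<tau> \<in> Sn n" and eq: "supp_M (l # ls) n \<tau> = supp_M (l # ls) n \<sigma>"
  shows "\<tau> = \<sigma>"
proof (rule ccontr)
  assume "\<tau> \<noteq> \<sigma>"
  then obtain x where x: "\<tau> x \<noteq> \<sigma> x" by blast
  have perm: "\<sigma> permutes {1..n}" "\<tau> permutes {1..n}" using Sn by (simp_all add: Sn_def)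
  have xn: "x \<in> {1..n}" using x perm by (metis permutes_not_in)
  define y where "y = inv \<tau> (\<sigma> x)"
  have \<tau>y: "\<tau> y = \<sigma> x" unfolding y_def using perm(2) by (simp add: permutes_inverses)
  have "\<sigma> x \<in> {1..n}" using perm(1) xn by (simp only: permutes_in_image)
  then have yn: "y \<in> {1..n}" using permutes_in_image[OF permutes_inv[OF perm(2)]] by (simp only: y_def)
  have xy: "x \<noteq> y" using \<tau>y x by auto
  obtain k ks where k: "ls = k # ks" using ls by (cases ls) auto
  have n: "n = l + sum_list ls" "0 < l" "0 < k" using part by (simp_all add: is_partition_def k)
  let ?t = "window_part ls n 0"
  have t: "?t \<in> lam_parts (l # ls) n" using window_part_mem[OF part, of 0] n by simp
  \<comment> \<open>Window 0 is an initial segment of length below \<open>n\<close>, so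
    \<open>n\<close> lies in block 0 and \<open>1\<close> in block 1. A permutation carrying them to
    \<open>x\<close> and \<open>y\<close> then gives the separating partition.\<close>
  have un: "n \<in> ?t ! 0" "n \<in> {1..n}" using n by (auto simp: window_part_def window_def)
  have wn: "1 \<in> ?t ! 1" "1 \<in> {1..n}" using n by (auto simp: window_part_def k)
  have "n \<noteq> 1" using n k by auto
  with ex_permutes_two_points[OF un(2) wn(2) xn yn _ xy] obtain \<rho>
    where \<rho>: "\<rho> permutes {1..n}" "\<rho> n = x" "\<rho> 1 = y" by blast
  define t' where "t' = act \<rho> ?t"
  have t': "t' \<in> lam_parts (l # ls) n" unfolding t'_def
    using act_mem_lam_parts[OF _ t] \<rho>(1) by (simp add: Sn_def)
  have len: "length ?t = Suc (length ls)" by (simp add: window_part_def)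
  have x0: "x \<in> t' ! 0" and y1: "y \<in> t' ! 1"
    using un(1) wn(1) \<rho>(2,3) len ls by (auto simp: t'_def act_def nth_map)
  have "(act \<sigma> t', t') \<in> supp_M (l # ls) n \<sigma>" using mem_supp_M_iff[OF Sn(1)] t' by simp
  then have "act \<sigma> t' = act \<tau> t'" using eq mem_supp_M_iff[OF Sn(2), of "(act \<sigma> t', t')" "l # ls"] by simp
  then have "act \<sigma> t' ! 0 = act \<tau> t' ! 0" by simp
  then have "\<sigma> ` (t' ! 0) = \<tau> ` (t' ! 0)" using len by (simp add: act_def t'_def nth_map)
  then have "\<sigma> x \<in> \<tau> ` (t' ! 0)" using x0 by blast
  then obtain z where z: "z \<in> t' ! 0" "\<tau> z = \<tau> y" using \<tau>y by auto
  then have "y \<in> t' ! 0" using permutes_inj[OF perm(2)] by (auto dest: injD)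
  moreover have "t' ! 0 \<inter> t' ! 1 = {}" using t' ls by (simp add: lam_parts_def)
  ultimately show False using y1 by blast
qed

section \<open>Counting permutations that fix test partitions\<close>

text \<open>Restriction to the sets \<open>B i\<close> and to the remaining points embeds the
  stabiliser into a product of symmetric groups.\<close>

lemma card_stabiliser_le:
  assumes "finite A" "finite I" "\<And>i. i \<in> I \<Longrightarrow> B i \<subseteq> A"
  shows "card {\<pi>. \<pi> permutes A \<and> (\<forall>i\<in>I. \<pi> ` B i = B i)}
    \<le> (\<Prod>i\<in>I. fact (card (B i))) * fact (card (A - (\<Union>i\<in>I. B i)))"
proof -
  define R where "R = A - (\<Union>i\<in>I. B i)"
  let ?X = "{\<pi>. \<pi> permutes A \<and> (\<forall>i\<in>I. \<pi> ` B i = B i)}"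
  \<comment> \<open>Restrictions are padded by the identity to satisfy
    \<open>permutes\<close>.\<close>
  let ?r = "\<lambda>\<pi> C x. if x \<in> C then \<pi> x else x"
  let ?Y = "(\<Pi>\<^sub>E i\<in>I. {\<pi>. \<pi> permutes B i}) \<times> {\<pi>. \<pi> permutes R}"
  let ?h = "\<lambda>\<pi>. (\<lambda>i\<in>I. ?r \<pi> (B i), ?r \<pi> R)"
  have finB: "finite (B i)" if "i \<in> I" for i using assms that finite_subset by blast
  have r: "?r \<pi> C permutes C" if "inj \<pi>" "\<pi> ` C = C" for \<pi> :: "'a \<Rightarrow> 'a" and C
  proof (rule bij_imp_permutes)
    have "bij_betw \<pi> C C" using that by (auto simp: bij_betw_def intro: inj_on_subset)
    then show "bij_betw (?r \<pi> C) C C" using bij_betw_cong[of C "?r \<pi> C" \<pi> C] by simp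
  qed simp
  have fin: "finite ?Y" using assms finB by (auto simp: R_def intro!: finite_PiE finite_permutations)
  have "?h ` ?X \<subseteq> ?Y"
  proof (rule image_subsetI)
    fix \<pi> assume \<pi>: "\<pi> \<in> ?X"
    then have inj: "inj \<pi>" by (auto intro: permutes_inj)
    have "\<pi> ` R = \<pi> ` A - (\<Union>i\<in>I. \<pi> ` B i)" using inj by (simp add: R_def image_set_diff image_UN)
    also have "\<dots> = R" using \<pi> by (auto simp: R_def permutes_image)
    finally show "?h \<pi> \<in> ?Y" using \<pi> r[OF inj] by simp
  qed
  moreover have "inj_on ?h ?X"
  proof (rule inj_onI)
    fix \<pi> \<pi>' assume \<pi>: "\<pi> \<in> ?X" and \<pi>': "\<pi>' \<in> ?X" and eq: "?h \<pi> = ?h \<pi>'"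
    show "\<pi> = \<pi>'"
    proof
      fix x
      consider "x \<notin> A" | i where "i \<in> I" "x \<in> B i" | "x \<in> R" unfolding R_def by blast
      then show "\<pi> x = \<pi>' x"
      proof cases
        case 1
        then show ?thesis using \<pi> \<pi>' permutes_not_in[of \<pi> A x] permutes_not_in[of \<pi>' A x] by simp
      next
        case (2 i)
        from eq have "(\<lambda>i\<in>I. ?r \<pi> (B i)) = (\<lambda>i\<in>I. ?r \<pi>' (B i))" by simp
        from fun_cong[OF this, of i] have "?r \<pi> (B i) = ?r \<pi>' (B i)" using 2(1) by simp
        from fun_cong[OF this, of x] show ?thesis using 2(2) by simp
      next
        case 3
        from eq have "?r \<pi> R = ?r \<pi>' R" by simp
        from fun_cong[OF this, of x] show ?thesis using 3 by simp
      qed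
    qed
  qed
  ultimately have "card ?X \<le> card ?Y" by (intro card_inj_on_le[of ?h] fin)
  also have "\<dots> = (\<Prod>i\<in>I. fact (card (B i))) * fact (card R)"
    using assms finB by (simp add: R_def card_cartesian_product card_PiE card_permutations cong: prod.cong)
  finally show ?thesis unfolding R_def .
qed

text \<open>Fixing a window partition fixes each of its small blocks setwise. The windows indexed by
  \<open>J\<close> are disjoint and fit into \<open>{1..n}\<close>, so the remaining points are
  counted exactly.\<close>

lemma card_window_stabiliser_le:
  assumes J: "J \<subseteq> {..<M}" and M: "M * sum_list ls \<le> n"
  shows "card {\<pi> \<in> Sn n. \<forall>m\<in>J. act \<pi> (window_part ls n m) = window_part ls n m}
    \<le> (\<Prod>i<length ls. fact (ls ! i)) ^ card J * fact (n - card J * sum_list ls)"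
proof -
  let ?I = "J \<times> {..<length ls}"
  let ?B = "\<lambda>(m, i). blocks (m * sum_list ls) ls ! i"
  have finJ: "finite J" using J finite_subset by blast
  have win: "window ls m \<subseteq> {1..n}" if "m \<in> J" for m
  proof (rule window_subset)
    have "Suc m * sum_list ls \<le> M * sum_list ls" using that J by (intro mult_le_mono1) auto
    then show "Suc m * sum_list ls \<le> n" using M by linarith
  qed
  have B_win: "?B (m, i) \<subseteq> window ls m" if "i < length ls" for m i
    using blocks_nth_subset[OF that] by (simp add: window_def)
  have U: "(\<Union>x\<in>?I. ?B x) = (\<Union>m\<in>J. window ls m)"
  proof -
    have "(\<Union>i<length ls. ?B (m, i)) = window ls m" for m
    proof -
      have "(\<Union>i<length ls. ?B (m, i)) = \<Union>(set (blocks (m * sum_list ls) ls))"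
        unfolding set_conv_nth by auto
      then show ?thesis by (simp add: Union_blocks window_def)
    qed
    then show ?thesis by fastforce
  qed
  have "card (\<Union>m\<in>J. window ls m) = card J * sum_list ls"
    using finJ by (subst card_UN_disjoint) (auto simp: windows_disjoint)
  then have cardR: "card ({1..n} - (\<Union>x\<in>?I. ?B x)) = n - card J * sum_list ls"
    unfolding U using win finJ by (subst card_Diff_subset) auto
  have "{\<pi> \<in> Sn n. \<forall>m\<in>J. act \<pi> (window_part ls n m) = window_part ls n m}
    \<subseteq> {\<pi>. \<pi> permutes {1..n} \<and> (\<forall>x\<in>?I. \<pi> ` ?B x = ?B x)}"
  proof clarify
    fix \<pi> assume \<pi>: "\<pi> \<in> Sn n" "\<forall>m\<in>J. act \<pi> (window_part ls n m) = window_part ls n m"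
    have "\<pi> ` ?B (m, i) = ?B (m, i)" if "m \<in> J" "i < length ls" for m i
    proof -
      \<comment> \<open>Block 0 of a window partition is the large one, so small block
        \<open>i\<close> sits at index \<open>Suc i\<close>.\<close>
      have "act \<pi> (window_part ls n m) ! Suc i = window_part ls n m ! Suc i" using \<pi>(2) that by simp
      then show ?thesis using that by (simp add: act_def window_part_def)
    qed
    then show "\<pi> permutes {1..n} \<and> (\<forall>x\<in>?I. \<pi> ` ?B x = ?B x)" using \<pi>(1) by (auto simp: Sn_def)
  qed
  then have "card {\<pi> \<in> Sn n. \<forall>m\<in>J. act \<pi> (window_part ls n m) = window_part ls n m}
    \<le> card {\<pi>. \<pi> permutes {1..n} \<and> (\<forall>x\<in>?I. \<pi> ` ?B x = ?B x)}"
    by (intro card_mono finite_subset[OF _ finite_permutations[of "{1..n}"]]) auto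
  also have "\<dots> \<le> (\<Prod>x\<in>?I. fact (card (?B x))) * fact (card ({1..n} - (\<Union>x\<in>?I. ?B x)))"
  proof (intro card_stabiliser_le)
    fix x assume "x \<in> ?I"
    then have "snd x < length ls" "fst x \<in> J" by auto
    then have "?B (fst x, snd x) \<subseteq> {1..n}" using B_win win by blast
    then show "?B x \<subseteq> {1..n}" by simp
  qed (use finJ in auto)
  also have "(\<Prod>x\<in>?I. fact (card (?B x))) = (\<Prod>x\<in>?I. fact (ls ! snd x) :: nat)"
    by (intro prod.cong) auto
  also have "\<dots> = (\<Prod>m\<in>J. \<Prod>i<length ls. fact (ls ! i))"
    unfolding prod.cartesian_product case_prod_beta ..
  finally show ?thesis unfolding cardR by simp
qed

text \<open>Left multiplication by \<open>inv s\<close> turns agreement with \<open>s\<close> into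
  fixing.\<close>

lemma card_act_agree_le:
  assumes s: "s \<in> Sn n"
  shows "card {\<sigma> \<in> Sn n. \<forall>m\<in>J. act \<sigma> (T m) = act s (T m)}
    \<le> card {\<pi> \<in> Sn n. \<forall>m\<in>J. act \<pi> (T m) = T m}"
proof -
  have sp: "s permutes {1..n}" using s by (simp add: Sn_def)
  have "{\<sigma> \<in> Sn n. \<forall>m\<in>J. act \<sigma> (T m) = act s (T m)}
    \<subseteq> (\<circ>) s ` {\<pi> \<in> Sn n. \<forall>m\<in>J. act \<pi> (T m) = T m}"
  proof clarify
    fix \<sigma> assume \<sigma>: "\<sigma> \<in> Sn n" "\<forall>m\<in>J. act \<sigma> (T m) = act s (T m)"
    have "\<sigma> = s \<circ> (inv s \<circ> \<sigma>)" using sp by (simp add: o_assoc permutes_inv_o)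
    moreover have "inv s \<circ> \<sigma> \<in> Sn n"
      using \<sigma>(1) sp by (auto simp: Sn_def intro: permutes_compose permutes_inv)
    moreover have "\<forall>m\<in>J. act (inv s \<circ> \<sigma>) (T m) = T m"
      using \<sigma>(2) act_inv_cancel[OF s] by (simp add: act_comp)
    ultimately show "\<sigma> \<in> (\<circ>) s ` {\<pi> \<in> Sn n. \<forall>m\<in>J. act \<pi> (T m) = T m}" by blast
  qed
  then show ?thesis by (rule surj_card_le[rotated]) simp
qed

section \<open>The random model\<close>

lemma Sn_nonempty [simp]: "Sn n \<noteq> {}"
  unfolding Sn_def using permutes_id by blast

lemma card_Sn [simp]: "card (Sn n) = fact n"
  unfolding Sn_def by (subst card_permutations[of _ n]) auto

abbreviation coord_R :: "nat \<Rightarrow> real \<Rightarrow> real \<Rightarrow> ((nat \<Rightarrow> nat) \<times> real) measure" where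
  "coord_R n a b \<equiv> measure_pmf (pmf_of_set (Sn n)) \<Otimes>\<^sub>M uniform_measure lborel {a..b}"

lemma prob_space_uniform_interval: "a < b \<Longrightarrow> prob_space (uniform_measure lborel {a..b::real})"
  by (rule prob_space_uniform_measure) auto

lemma prob_space_coord_R: "a < b \<Longrightarrow> prob_space (coord_R n a b)"
  by (intro prob_space_pair prob_space_measure_pmf prob_space_uniform_interval)

lemma sets_coord_R_cylinder: "A \<times> UNIV \<in> sets (coord_R n a b)"
  by (intro pair_measureI) auto

lemma measure_coord_R_cylinder:
  assumes "a < b"
  shows "measure (coord_R n a b) (A \<times> UNIV) = measure (pmf_of_set (Sn n)) A"
proof -
  interpret U: prob_space "uniform_measure lborel {a..b}"
    using assms by (rule prob_space_uniform_interval)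
  have "emeasure (coord_R n a b) (A \<times> UNIV)
    = emeasure (pmf_of_set (Sn n)) A * emeasure (uniform_measure lborel {a..b}) UNIV"
    by (rule U.emeasure_pair_measure_Times) auto
  also have "emeasure (uniform_measure lborel {a..b}) UNIV = 1" using U.emeasure_space_1 by simp
  finally show ?thesis by (simp add: measure_def)
qed

section \<open>Union bound for samples without a witness\<close>

definition sigma_box :: "nat \<Rightarrow> (nat \<Rightarrow> (nat \<Rightarrow> nat) set) \<Rightarrow> (nat \<Rightarrow> (nat \<Rightarrow> nat) \<times> real) set" where
  "sigma_box K A = (\<Pi>\<^sub>E j\<in>{..<K}. A j \<times> UNIV)"

lemma sets_sigma_box [measurable]: "sigma_box K A \<in> sets (model_R n K a b)"
  unfolding model_R_def sigma_box_def by (intro sets_PiM_I_finite sets_coord_R_cylinder) auto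

lemma measure_sigma_box:
  assumes "a < b"
  shows "measure (model_R n K a b) (sigma_box K A) = (\<Prod>j<K. measure (pmf_of_set (Sn n)) (A j))"
proof -
  interpret prob_space "coord_R n a b" using assms by (rule prob_space_coord_R)
  interpret finite_product_prob_space "\<lambda>_::nat. coord_R n a b" "{..<K}" by unfold_locales auto
  show ?thesis unfolding model_R_def sigma_box_def
    by (subst finite_measure_PiM_emb) (auto intro: sets_coord_R_cylinder simp: measure_coord_R_cylinder assms)
qed

text \<open>Sample \<open>\<phi> m\<close> spoils test partition \<open>m\<close> for sample
  \<open>i\<close>. Fixing the permutation \<open>s\<close> of sample \<open>i\<close> makes this
  event a product of conditions on separate samples.\<close>

definition agree_box ::
  "nat \<Rightarrow> nat \<Rightarrow> nat \<Rightarrow> (nat \<Rightarrow> nat set list) \<Rightarrow> nat \<Rightarrow> (nat \<Rightarrow> nat) \<Rightarrow> (nat \<Rightarrow> nat)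
    \<Rightarrow> (nat \<Rightarrow> (nat \<Rightarrow> nat) \<times> real) set" where
  "agree_box n K M T i \<phi> s = sigma_box K (\<lambda>j. if j = i then {s}
     else {\<sigma> \<in> Sn n. \<forall>m\<in>{m\<in>{..<M}. \<phi> m = j}. act \<sigma> (T m) = act s (T m)})"

text \<open>Sample \<open>i\<close> contributes \<open>1 / fact n\<close>, and any other sample
  \<open>j\<close> at most \<open>\<rho>\<close> to the size of the fibre of \<open>\<phi>\<close>
  over \<open>j\<close>. As \<open>\<phi>\<close> avoids \<open>i\<close>, these sizes add up to
  \<open>M\<close>.\<close>

lemma measure_agree_box_le:
  assumes ab: "a < b" and s: "s \<in> Sn n" and i: "i < K" and \<phi>: "\<phi> ` {..<M} \<subseteq> {..<K} - {i}"
    and \<rho>: "\<And>J. J \<subseteq> {..<M} \<Longrightarrow> real (card {\<pi> \<in> Sn n. \<forall>m\<in>J. act \<pi> (T m) = T m}) \<le> \<rho> ^ card J * fact n"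
  shows "measure (model_R n K a b) (agree_box n K M T i \<phi> s) \<le> \<rho> ^ M / fact n"
proof -
  let ?J = "\<lambda>j. {m\<in>{..<M}. \<phi> m = j}"
  let ?A = "\<lambda>j. {\<sigma> \<in> Sn n. \<forall>m\<in>?J j. act \<sigma> (T m) = act s (T m)}"
  let ?\<mu> = "\<lambda>A. measure (pmf_of_set (Sn n)) A"
  have \<mu>: "?\<mu> A = real (card (Sn n \<inter> A)) / fact n" for A by (simp add: measure_pmf_of_set)
  have le: "?\<mu> (?A j) \<le> (\<Prod>m\<in>?J j. \<rho>)" for j
  proof -
    have "real (card (?A j)) \<le> real (card {\<pi> \<in> Sn n. \<forall>m\<in>?J j. act \<pi> (T m) = T m})"
      using card_act_agree_le[OF s, of "?J j" T] by linarith
    also have "\<dots> \<le> \<rho> ^ card (?J j) * fact n" by (rule \<rho>) auto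
    finally have "real (card (?A j)) / fact n \<le> \<rho> ^ card (?J j)" by (simp add: field_simps)
    moreover have "Sn n \<inter> ?A j = ?A j" by blast
    ultimately show ?thesis unfolding \<mu> by simp
  qed
  have "measure (model_R n K a b) (agree_box n K M T i \<phi> s)
    = (\<Prod>j<K. ?\<mu> (if j = i then {s} else ?A j))"
    unfolding agree_box_def by (rule measure_sigma_box[OF ab])
  also have "\<dots> = ?\<mu> {s} * (\<Prod>j\<in>{..<K} - {i}. ?\<mu> (?A j))"
    using i by (subst prod.remove[of _ i]) (auto intro!: prod.cong)
  also have "?\<mu> {s} = 1 / fact n" using s unfolding \<mu> by simp
  also have "1 / fact n * (\<Prod>j\<in>{..<K} - {i}. ?\<mu> (?A j))
    \<le> 1 / fact n * (\<Prod>j\<in>{..<K} - {i}. \<Prod>m\<in>?J j. \<rho>)"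
    using le by (intro mult_left_mono prod_mono conjI) auto
  also have "(\<Prod>j\<in>{..<K} - {i}. \<Prod>m\<in>?J j. \<rho>) = (\<Prod>m<M. \<rho>)"
    using \<phi> by (intro prod.group) auto
  finally show ?thesis by simp
qed

text \<open>If some \<open>i\<close> has no witness among the \<open>T m\<close>, let \<open>\<phi> m \<noteq> i\<close> be an index agreeing with \<open>i\<close> on
  \<open>T m\<close>; the union bound runs over \<open>i\<close>, \<open>\<phi>\<close> and the value \<open>s\<close> of the \<open>i\<close>-th permutation.\<close>

lemma unwitnessed_measure_le:
  assumes ab: "a < b"
    and \<rho>: "\<And>J. J \<subseteq> {..<M} \<Longrightarrow> real (card {\<pi> \<in> Sn n. \<forall>m\<in>J. act \<pi> (T m) = T m}) \<le> \<rho> ^ card J * fact n"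
    and \<rho>0: "0 \<le> \<rho>"
  shows "\<exists>E\<in>sets (model_R n K a b). measure (model_R n K a b) E \<le> real K ^ (M + 1) * \<rho> ^ M \<and>
    (\<forall>\<omega>\<in>space (model_R n K a b) - E. (\<forall>i<K. fst (\<omega> i) \<in> Sn n) \<longrightarrow>
      (\<forall>i<K. \<exists>m<M. \<forall>j<K. j \<noteq> i \<longrightarrow> act (fst (\<omega> j)) (T m) \<noteq> act (fst (\<omega> i)) (T m)))"
proof -
  let ?R = "model_R n K a b"
  let ?\<Phi> = "\<lambda>i. {..<M} \<rightarrow>\<^sub>E ({..<K} - {i})"
  let ?box = "agree_box n K M T"
  have fin\<Phi>: "finite (?\<Phi> i)" for i by (intro finite_PiE) auto
  have box: "?box i \<phi> s \<in> sets ?R" for i \<phi> s unfolding agree_box_def by (rule sets_sigma_box)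
  have box1: "(\<Union>s\<in>Sn n. ?box i \<phi> s) \<in> sets ?R" for i \<phi> using box by (intro sets.finite_UN) auto
  have box2: "(\<Union>\<phi>\<in>?\<Phi> i. \<Union>s\<in>Sn n. ?box i \<phi> s) \<in> sets ?R" for i
    using box fin\<Phi> by (intro sets.finite_UN) auto
  define E where "E = (\<Union>i<K. \<Union>\<phi>\<in>?\<Phi> i. \<Union>s\<in>Sn n. ?box i \<phi> s)"
  have E: "E \<in> sets ?R" unfolding E_def using box fin\<Phi> by (intro sets.finite_UN) auto
  have le1: "measure ?R (\<Union>s\<in>Sn n. ?box i \<phi> s) \<le> \<rho> ^ M" if "i < K" "\<phi> \<in> ?\<Phi> i" for i \<phi>
  proof -
    have "measure ?R (\<Union>s\<in>Sn n. ?box i \<phi> s) \<le> (\<Sum>s\<in>Sn n. measure ?R (?box i \<phi> s))"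
      using box by (intro measure_UNION_le) auto
    \<comment> \<open>Summing over the \<open>fact n\<close> values of \<open>s\<close> cancels the
      probability \<open>1 / fact n\<close>.\<close>
    also have "\<dots> \<le> (\<Sum>s\<in>Sn n. \<rho> ^ M / fact n)"
      using that by (intro sum_mono measure_agree_box_le[OF ab _ _ _ \<rho>]) auto
    finally show ?thesis by simp
  qed
  have le2: "measure ?R (\<Union>\<phi>\<in>?\<Phi> i. \<Union>s\<in>Sn n. ?box i \<phi> s) \<le> real K ^ M * \<rho> ^ M" if "i < K" for i
  proof -
    have "measure ?R (\<Union>\<phi>\<in>?\<Phi> i. \<Union>s\<in>Sn n. ?box i \<phi> s)
      \<le> (\<Sum>\<phi>\<in>?\<Phi> i. measure ?R (\<Union>s\<in>Sn n. ?box i \<phi> s))"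
      using box1 fin\<Phi> by (intro measure_UNION_le) auto
    also have "\<dots> \<le> (\<Sum>\<phi>\<in>?\<Phi> i. \<rho> ^ M)" using that le1 by (intro sum_mono) auto
    also have "\<dots> = real (K - 1) ^ M * \<rho> ^ M" using that by (simp add: card_PiE)
    also have "\<dots> \<le> real K ^ M * \<rho> ^ M" using \<rho>0 by (intro mult_right_mono power_mono) auto
    finally show ?thesis .
  qed
  have "measure ?R E \<le> (\<Sum>i<K. measure ?R (\<Union>\<phi>\<in>?\<Phi> i. \<Union>s\<in>Sn n. ?box i \<phi> s))"
    unfolding E_def using box2 by (intro measure_UNION_le) auto
  also have "\<dots> \<le> (\<Sum>i<K. real K ^ M * \<rho> ^ M)" using le2 by (intro sum_mono) auto
  finally have mE: "measure ?R E \<le> real K ^ (M + 1) * \<rho> ^ M" by simp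
  have wit: "\<exists>m<M. \<forall>j<K. j \<noteq> i \<longrightarrow> act (fst (\<omega> j)) (T m) \<noteq> act (fst (\<omega> i)) (T m)"
    if \<omega>: "\<omega> \<in> space ?R - E" and Sn: "\<forall>i<K. fst (\<omega> i) \<in> Sn n" and i: "i < K" for \<omega> i
  proof (rule ccontr)
    assume "\<not> ?thesis"
    then have "\<forall>m\<in>{..<M}. \<exists>j. j < K \<and> j \<noteq> i \<and> act (fst (\<omega> j)) (T m) = act (fst (\<omega> i)) (T m)" by auto
    then obtain f where f: "\<And>m. m \<in> {..<M} \<Longrightarrow> f m < K \<and> f m \<noteq> i \<and> act (fst (\<omega> (f m))) (T m) = act (fst (\<omega> i)) (T m)"
      by (metis (no_types, lifting) bchoice)
    \<comment> \<open>The restriction makes the choice function one of the finitely many members of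
      \<open>PiE\<close> over which \<open>E\<close> is a union.\<close>
    define \<phi> where "\<phi> = restrict f {..<M}"
    have \<phi>: "\<phi> \<in> ?\<Phi> i" using f by (auto simp: \<phi>_def)
    have ext: "\<omega> \<in> extensional {..<K}" using \<omega> by (auto simp: model_R_def space_PiM PiE_def)
    have "\<omega> \<in> ?box i \<phi> (fst (\<omega> i))"
      unfolding agree_box_def sigma_box_def using ext Sn f by (auto simp: PiE_iff mem_Times_iff \<phi>_def)
    then show False using \<omega> \<phi> Sn i unfolding E_def by blast
  qed
  show ?thesis using E mE wit by blast
qed

section \<open>Almost sure genericity of the values\<close>

text \<open>With all samples but \<open>j\<close> held fixed, equality of the sums forces the value
  of sample \<open>j\<close> to a single point, which the uniform law does not charge; Fubini
  concludes.\<close>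

lemma AE_subset_sums_neq:
  assumes ab: "a < b" and S: "S \<subseteq> {..<K}" "S' \<subseteq> {..<K}" and j: "j \<in> S" "j \<notin> S'"
  shows "AE \<omega> in model_R n K a b. (\<Sum>i\<in>S. snd (\<omega> i)) \<noteq> (\<Sum>i\<in>S'. snd (\<omega> i))"
proof -
  let ?N = "coord_R n a b"
  let ?I = "{..<K} - {j}"
  have fin: "finite S" "finite S'" using S finite_subset by blast+
  have ins: "insert j ?I = {..<K}" using S j by auto
  interpret prob_space ?N using ab by (rule prob_space_coord_R)
  interpret product_sigma_finite "\<lambda>_::nat. ?N" by unfold_locales
  interpret U: prob_space "uniform_measure lborel {a..b}"
    using ab by (rule prob_space_uniform_interval)
  let ?B = "{\<omega> \<in> space (PiM {..<K} (\<lambda>_. ?N)). (\<Sum>i\<in>S. snd (\<omega> i)) = (\<Sum>i\<in>S'. snd (\<omega> i))}"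
  have meas: "(\<lambda>\<omega>. \<Sum>i\<in>A. snd (\<omega> i)) \<in> borel_measurable (PiM {..<K} (\<lambda>_. ?N))" if "A \<subseteq> {..<K}" for A
  proof (rule borel_measurable_sum)
    fix i assume "i \<in> A"
    then have "(\<lambda>\<omega>. \<omega> i) \<in> measurable (PiM {..<K} (\<lambda>_. ?N)) ?N"
      using that by (intro measurable_component_singleton) auto
    moreover have "snd \<in> borel_measurable ?N"
      using measurable_snd[of "measure_pmf (pmf_of_set (Sn n))" "uniform_measure lborel {a..b}"]
      by (simp cong: measurable_cong_sets)
    ultimately show "(\<lambda>\<omega>. snd (\<omega> i)) \<in> borel_measurable (PiM {..<K} (\<lambda>_. ?N))"
      by (rule measurable_compose)
  qed
  have B: "?B \<in> sets (PiM {..<K} (\<lambda>_. ?N))"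
    using meas[OF S(1)] meas[OF S(2)] by (rule borel_measurable_eq)
  have Bm: "indicator ?B \<in> borel_measurable (PiM (insert j ?I) (\<lambda>_. ?N))"
    unfolding ins using B by (rule borel_measurable_indicator)
  have "emeasure (PiM {..<K} (\<lambda>_. ?N)) ?B = (\<integral>\<^sup>+\<omega>. indicator ?B \<omega> \<partial>PiM (insert j ?I) (\<lambda>_. ?N))"
    using B unfolding ins by simp
  also have "\<dots> = (\<integral>\<^sup>+x. (\<integral>\<^sup>+y. indicator ?B (x(j := y)) \<partial>?N) \<partial>PiM ?I (\<lambda>_. ?N))"
    using Bm by (intro product_nn_integral_insert) auto
  also have "\<dots> = (\<integral>\<^sup>+x. 0 \<partial>PiM ?I (\<lambda>_. ?N))"
  proof (intro nn_integral_cong)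
    fix x :: "nat \<Rightarrow> (nat \<Rightarrow> nat) \<times> real"
    \<comment> \<open>The only value of sample \<open>j\<close> compatible with equality; it depends
      on the other samples alone because \<open>j\<close> is not in \<open>S'\<close>.\<close>
    define c where "c = (\<Sum>i\<in>S'. snd (x i)) - (\<Sum>i\<in>S - {j}. snd (x i))"
    have c: "snd y = c" if "x(j := y) \<in> ?B" for y
    proof -
      have "(\<Sum>i\<in>S. snd ((x(j := y)) i)) = snd y + (\<Sum>i\<in>S - {j}. snd (x i))"
        using fin j by (subst sum.remove[of _ j]) auto
      moreover have "(\<Sum>i\<in>S'. snd ((x(j := y)) i)) = (\<Sum>i\<in>S'. snd (x i))"
        using j by (intro sum.cong) auto
      ultimately show ?thesis using that by (simp add: c_def)
    qed
    have UC: "UNIV \<times> {c} \<in> sets ?N" by (rule pair_measureI) auto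
    have "(\<integral>\<^sup>+y. indicator ?B (x(j := y)) \<partial>?N) \<le> (\<integral>\<^sup>+y. indicator (UNIV \<times> {c}) y \<partial>?N)"
    proof (rule nn_integral_mono)
      fix y
      show "indicator ?B (x(j := y)) \<le> (indicator (UNIV \<times> {c}) y :: ennreal)"
      proof (cases "x(j := y) \<in> ?B")
        case True
        have "y \<in> UNIV \<times> {c}" using c[OF True] by (simp add: mem_Times_iff)
        then have "indicator (UNIV \<times> {c}) y = (1 :: ennreal)" by (rule indicator_simps(1))
        moreover have "indicator ?B (x(j := y)) = (1 :: ennreal)" using True by (rule indicator_simps(1))
        ultimately show ?thesis by simp
      next
        case False
        then have "indicator ?B (x(j := y)) = (0 :: ennreal)" by (rule indicator_simps(2))
        then show ?thesis by simp
      qed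
    qed
    also have "\<dots> = emeasure ?N (UNIV \<times> {c})" by (rule nn_integral_indicator[OF UC])
    also have "\<dots> = emeasure (pmf_of_set (Sn n)) UNIV * emeasure (uniform_measure lborel {a..b}) {c}"
      by (rule U.emeasure_pair_measure_Times) auto
    also have "emeasure (uniform_measure lborel {a..b}) {c} = 0"
    proof -
      have "emeasure lborel ({a..b} \<inter> {c}) \<le> emeasure lborel {c}" by (intro emeasure_mono) auto
      then have "emeasure lborel ({a..b} \<inter> {c}) = 0" by simp
      then show ?thesis by (subst emeasure_uniform_measure) auto
    qed
    finally show "(\<integral>\<^sup>+y. indicator ?B (x(j := y)) \<partial>?N) = 0"
      by (simp only: mult_zero_right le_zero_eq)
  qed
  finally have "emeasure (PiM {..<K} (\<lambda>_. ?N)) ?B = 0" by simp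
  then show ?thesis unfolding model_R_def by (intro AE_I[OF _ _ B]) auto
qed

text \<open>Each property is a finite intersection of almost sure events. For subset sums, two
  different sets are told apart by an index lying in just one of them, hence the two symmetric
  cases.\<close>

lemma AE_model_R_generic:
  assumes a: "0 < a" and ab: "a < b"
  shows "AE \<omega> in model_R n K a b. (\<forall>i<K. fst (\<omega> i) \<in> Sn n) \<and> (\<forall>i<K. 0 < snd (\<omega> i)) \<and>
    inj_on (sum (\<lambda>i. snd (\<omega> i))) (Pow {..<K})"
proof -
  have prob: "prob_space (coord_R n a b)" using ab by (rule prob_space_coord_R)
  have "AE y in coord_R n a b. fst y \<in> Sn n"
  proof (rule AE_distrD[where P = "\<lambda>s. s \<in> Sn n"])
    show "fst \<in> measurable (coord_R n a b) (measure_pmf (pmf_of_set (Sn n)))" by simp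
    have "AE s in measure_pmf (pmf_of_set (Sn n)). s \<in> Sn n"
      by (simp add: AE_measure_pmf_iff)
    then show "AE s in distr (coord_R n a b) (measure_pmf (pmf_of_set (Sn n))) fst. s \<in> Sn n"
      by (simp only: prob_space.distr_pair_fst[OF prob_space_uniform_interval[OF ab]])
  qed
  then have "AE \<omega> in model_R n K a b. fst (\<omega> i) \<in> Sn n" if "i \<in> {..<K}" for i
    unfolding model_R_def using that prob
    by (intro AE_PiM_component[where P = "\<lambda>y. fst y \<in> Sn n"]) auto
  then have 1: "AE \<omega> in model_R n K a b. \<forall>i\<in>{..<K}. fst (\<omega> i) \<in> Sn n"
    by (intro AE_finite_allI) auto
  have "AE y in coord_R n a b. 0 < snd y"
  proof -
    interpret P: pair_prob_space "measure_pmf (pmf_of_set (Sn n))" "uniform_measure lborel {a..b}"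
      using prob_space_uniform_interval[OF ab] prob_space_measure_pmf
      by (auto simp: pair_prob_space_def pair_sigma_finite_def prob_space_imp_sigma_finite)
    have "AE v in uniform_measure lborel {a..b}. 0 < v"
      using a by (intro AE_uniform_measureI) auto
    then show ?thesis
      by (intro P.AE_pair_measure) auto
  qed
  then have "AE \<omega> in model_R n K a b. 0 < snd (\<omega> i)" if "i \<in> {..<K}" for i
    unfolding model_R_def using that prob
    by (intro AE_PiM_component[where P = "\<lambda>y. 0 < snd y"]) auto
  then have 2: "AE \<omega> in model_R n K a b. \<forall>i\<in>{..<K}. 0 < snd (\<omega> i)"
    by (intro AE_finite_allI) auto
  have "AE \<omega> in model_R n K a b. (\<Sum>i\<in>fst X. snd (\<omega> i)) = (\<Sum>i\<in>snd X. snd (\<omega> i)) \<longrightarrow> fst X = snd X"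
    if "X \<in> Pow {..<K} \<times> Pow {..<K}" for X
  proof (cases "fst X = snd X")
    case False
    then consider j where "j \<in> fst X" "j \<notin> snd X"
      | j where "j \<in> snd X" "j \<notin> fst X" by blast
    then show ?thesis
    proof cases
      case 1
      with that have "AE \<omega> in model_R n K a b. (\<Sum>i\<in>fst X. snd (\<omega> i)) \<noteq> (\<Sum>i\<in>snd X. snd (\<omega> i))"
        by (intro AE_subset_sums_neq[OF ab, of _ _ _ j]) auto
      then show ?thesis by eventually_elim auto
    next
      case 2
      with that have "AE \<omega> in model_R n K a b. (\<Sum>i\<in>snd X. snd (\<omega> i)) \<noteq> (\<Sum>i\<in>fst X. snd (\<omega> i))"
        by (intro AE_subset_sums_neq[OF ab, of _ _ _ j]) auto
      then show ?thesis by eventually_elim auto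
    qed
  qed auto
  then have 3: "AE \<omega> in model_R n K a b. \<forall>X\<in>Pow {..<K} \<times> Pow {..<K}.
      (\<Sum>i\<in>fst X. snd (\<omega> i)) = (\<Sum>i\<in>snd X. snd (\<omega> i)) \<longrightarrow> fst X = snd X"
    by (intro AE_finite_allI) auto
  from 1 2 3 show ?thesis
    by eventually_elim (auto simp: inj_on_def)
qed

section \<open>Estimates\<close>

text \<open>The AM-GM bound for the factors 1 to \<open>k\<close>, here by induction with Bernoulli.
  The factor 1/2 matters: with \<open>k ^ k\<close> instead, the comparison in
  \<open>ln_part_le\<close> would fail near \<open>2 * k = n\<close>.\<close>

lemma fact_le_half_power: "(fact k :: real) \<le> ((real k + 1) / 2) ^ k"
proof (induction k)
  case (Suc k)
  let ?x = "(real k + 1) / 2"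
  have "2 \<le> (1 + 1 / (real k + 1)) ^ Suc k"
    using Bernoulli_inequality[of "1 / (real k + 1)" "Suc k"] by (simp add: field_simps)
  then have "2 * ?x ^ Suc k \<le> (1 + 1 / (real k + 1)) ^ Suc k * ?x ^ Suc k"
    by (intro mult_right_mono) auto
  also have "\<dots> = ((1 + 1 / (real k + 1)) * ?x) ^ Suc k" by (simp only: power_mult_distrib)
  also have "(1 + 1 / (real k + 1)) * ?x = (real (Suc k) + 1) / 2" by (simp add: field_simps)
  finally have *: "2 * ?x ^ Suc k \<le> ((real (Suc k) + 1) / 2) ^ Suc k" .
  have "(fact (Suc k) :: real) = 2 * ?x * fact k" by (simp add: field_simps)
  also have "\<dots> \<le> 2 * ?x * ?x ^ k" using Suc by (intro mult_left_mono) auto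
  also have "\<dots> = 2 * ?x ^ Suc k" by simp
  finally show ?case using * by linarith
qed simp

lemma power_le_exp_fact: "real k ^ k \<le> exp (real k) * fact k"
proof -
  have s: "summable (\<lambda>m. real k ^ m /\<^sub>R fact m)" using summable_exp_generic by blast
  \<comment> \<open>Only the term of index \<open>k\<close> of the exponential series is
    kept.\<close>
  have "(\<Sum>m\<in>{k}. real k ^ m /\<^sub>R fact m) \<le> (\<Sum>m. real k ^ m /\<^sub>R fact m)"
    using s by (intro sum_le_suminf) auto
  then have "real k ^ k /\<^sub>R fact k \<le> exp (real k)" by (simp add: exp_def)
  then show ?thesis by (simp add: field_simps)
qed

text \<open>Combines \<open>(n/k)^k \<le> n choose k\<close> with
  \<open>k^k \<le> exp k * fact k\<close>; splitting off \<open>k = 0\<close> avoids the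
  division.\<close>

lemma power_fact_diff_le:
  assumes "k \<le> n"
  shows "real n ^ k * fact (n - k) \<le> exp (real k) * fact n"
proof (cases "k = 0")
  case False
  have "(real n / real k) ^ k \<le> real (n choose k)"
    using binomial_ge_n_over_k_pow_k[OF assms, where 'a = real] by simp
  then have "real n ^ k \<le> real (n choose k) * real k ^ k"
    using False by (simp add: power_divide field_simps)
  also have "\<dots> \<le> real (n choose k) * (exp (real k) * fact k)"
    by (intro mult_left_mono power_le_exp_fact) auto
  finally have "real n ^ k * fact (n - k) \<le> real (n choose k) * (exp (real k) * fact k) * fact (n - k)"
    by (intro mult_right_mono) auto
  also have "\<dots> = exp (real k) * fact n"
    using binomial_fact_lemma[OF assms] by (metis (no_types, lifting) mult.assoc mult.commute of_nat_fact of_nat_mult)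
  finally show ?thesis .
qed simp

lemma fact_le_power_fact_diff:
  assumes "k \<le> n"
  shows "(fact n :: real) \<le> real n ^ k * fact (n - k)"
proof -
  have "fact (n - k) dvd (fact n :: nat)" by (simp add: fact_dvd)
  then have "(fact n :: nat) = fact n div fact (n - k) * fact (n - k)" by simp
  also have "\<dots> \<le> n ^ k * fact (n - k)" using fact_div_fact_le_pow[OF assms] by simp
  finally have "real (fact n) \<le> real (n ^ k * fact (n - k))" by (rule of_nat_mono)
  then show ?thesis by simp
qed

text \<open>Compares the entropy term of a small part of size \<open>k\<close> with its share in the
  lower bound for the logarithm of \<open>D_lam\<close>, both divided by \<open>k\<close>.\<close>

lemma ln_part_le:
  assumes n: "40 \<le> n" and k: "0 < k" "2 * k \<le> n"
  shows "ln (real n / real k) \<le> 4 * (ln (real n) - 1 - ln ((real k + 1) / 2))"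
proof -
  define y where "y = real n / real k"
  have y2: "2 \<le> y" using k by (simp add: y_def field_simps)
  have e4: "exp 4 \<le> (55::real)"
  proof -
    have "exp 4 = exp (1::real) ^ 4" by (simp flip: exp_of_nat_mult)
    also have "\<dots> \<le> (272/100) ^ 4" using e_less_272 by (intro power_mono) auto
    finally show ?thesis by (simp add: power_divide)
  qed
  \<comment> \<open>The claim in exponentiated form. For \<open>k < 10\<close> the hypothesis
    \<open>40 \<le> n\<close> gives \<open>y \<ge> 4\<close>, and 1024 exceeds 880; for larger
    \<open>k\<close> already \<open>y \<ge> 2\<close> suffices because \<open>1 + 1/k\<close> is at
    most 11/10.\<close>
  have key: "exp 4 * (1 + 1 / real k) ^ 4 \<le> 16 * y ^ 3"
  proof (cases "k < 10")
    case True
    have "real k \<le> 10" "40 \<le> real n" using n True by auto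
    then have "4 \<le> y" using k by (simp add: y_def field_simps)
    then have "4 ^ 3 \<le> y ^ 3" by (intro power_mono) auto
    moreover have "(1 + 1 / real k) ^ 4 \<le> 2 ^ 4" using k by (intro power_mono) auto
    then have "exp 4 * (1 + 1 / real k) ^ 4 \<le> 55 * 2 ^ 4" using e4 by (intro mult_mono) auto
    ultimately show ?thesis by simp
  next
    case False
    have "2 ^ 3 \<le> y ^ 3" using y2 by (intro power_mono) auto
    moreover have "(1 + 1 / real k) ^ 4 \<le> (11/10) ^ 4"
      using False by (intro power_mono) (auto simp: field_simps)
    then have "exp 4 * (1 + 1 / real k) ^ 4 \<le> 55 * (11/10) ^ 4" using e4 by (intro mult_mono) auto
    ultimately show ?thesis by (simp add: power_divide)
  qed
  have pos: "0 < 1 + 1 / real k" by (simp add: add_pos_nonneg)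
  have "4 + 4 * ln (1 + 1 / real k) = ln (exp 4 * (1 + 1 / real k) ^ 4)"
    using pos by (subst ln_mult) (auto simp: ln_realpow)
  also have "\<dots> \<le> ln (16 * y ^ 3)" using key pos y2
    by (subst ln_le_cancel_iff) auto
  also have "\<dots> = ln (2 ^ 4) + 3 * ln y" using y2 by (subst ln_mult) (auto simp: ln_realpow)
  also have "ln (2 ^ 4 :: real) = 4 * ln 2" by (subst ln_realpow) auto
  finally have 1: "4 + 4 * ln (1 + 1 / real k) \<le> 4 * ln 2 + 3 * ln y" .
  have "real k + 1 = real k * (1 + 1 / real k)" using k by (simp add: field_simps)
  then have "ln (real k + 1) = ln (real k * (1 + 1 / real k))" by presburger
  also have "\<dots> = ln (real k) + ln (1 + 1 / real k)" using k pos by (subst ln_mult) auto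
  finally have "ln ((real k + 1) / 2) = ln (real k) + ln (1 + 1 / real k) - ln 2"
    by (simp add: ln_div)
  moreover have "ln y = ln (real n) - ln (real k)" using k n by (simp add: y_def ln_div)
  ultimately show ?thesis using 1 unfolding y_def[symmetric] by argo
qed

section \<open>Entropy against the logarithm of \<open>D_lam\<close>\<close>

lemma partition_ConsD:
  assumes "is_partition (l # ls) n"
  shows "n = l + sum_list ls" "0 < l"
    "\<And>i. i < length ls \<Longrightarrow> 0 < ls ! i" "\<And>i. i < length ls \<Longrightarrow> 2 * ls ! i \<le> n"
proof -
  show n: "n = l + sum_list ls" "0 < l" and "\<And>i. i < length ls \<Longrightarrow> 0 < ls ! i"
    using assms by (auto simp: is_partition_def)
  show "2 * ls ! i \<le> n" if "i < length ls" for i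
  proof -
    have "ls ! i \<le> l" using assms that by (simp add: is_partition_def)
    moreover have "ls ! i \<le> sum_list ls" using that by (rule elem_le_sum_list)
    ultimately show ?thesis using n(1) by simp
  qed
qed

lemma D_lam_Cons:
  "D_lam (l # ls) n = fact n / (fact l * (\<Prod>i<length ls. fact (ls ! i)))"
  unfolding D_lam_def by (simp add: prod.lessThan_Suc_shift del: prod.lessThan_Suc)

lemma H_ent_diff:
  assumes "0 < l" "0 < n"
  shows "real n * (H_ent (l # ls) n - H'_ent (l # ls) n) = real l * ln (real n / real l)"
proof -
  let ?f = "\<lambda>i. alpha (l # ls) n i * ln (alpha (l # ls) n i)"
  have "sum ?f {..<length (l # ls)} = ?f 0 + sum ?f {1..<length (l # ls)}"
    by (simp add: sum.lessThan_Suc_shift sum.shift_bounds_Suc_ivl atLeast0LessThan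
        del: sum.lessThan_Suc sum.op_ivl_Suc)
  then have *: "H_ent (l # ls) n - H'_ent (l # ls) n = - (real l / real n * ln (real l / real n))"
    by (simp add: H_ent_def H'_ent_def alpha_def)
  show ?thesis unfolding * using assms by (simp add: ln_div algebra_simps)
qed

lemma H'_ent_Cons:
  assumes "0 < n" "\<And>i. i < length ls \<Longrightarrow> 0 < ls ! i"
  shows "real n * H'_ent (l # ls) n = (\<Sum>i<length ls. real (ls ! i) * ln (real n / real (ls ! i)))"
proof -
  let ?f = "\<lambda>i. alpha (l # ls) n i * ln (alpha (l # ls) n i)"
  have "sum ?f {1..<length (l # ls)} = (\<Sum>i<length ls. real (ls ! i) / real n * ln (real (ls ! i) / real n))"
    by (simp add: sum.shift_bounds_Suc_ivl atLeast0LessThan alpha_def del: sum.op_ivl_Suc)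
  then have "real n * H'_ent (l # ls) n
    = (\<Sum>i<length ls. - (real n * (real (ls ! i) / real n * ln (real (ls ! i) / real n))))"
    unfolding H'_ent_def by (simp only: sum_distrib_left sum_negf mult_minus_right)
  also have "\<dots> = (\<Sum>i<length ls. real (ls ! i) * ln (real n / real (ls ! i)))"
    using assms by (intro sum.cong) (auto simp: ln_div algebra_simps)
  finally show ?thesis .
qed

lemma real_sum_list_nth: "real (sum_list ls) = (\<Sum>i<length ls. real (ls ! i))"
  by (simp add: sum_list_sum_nth atLeast0LessThan)

text \<open>The quotient \<open>fact n / fact l\<close> is at least \<open>(n/e)^d\<close> and the
  small factorials obey \<open>fact_le_half_power\<close>. Since the small parts sum to
  \<open>d\<close>, this bound splits into one share per part, to which \<open>ln_part_le\<close>
  applies.\<close>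

lemma ln_D_lam_ge_H':
  assumes part: "is_partition (l # ls) n" and n: "40 \<le> n"
  shows "real n * H'_ent (l # ls) n \<le> 4 * ln (D_lam (l # ls) n)"
proof -
  note p = partition_ConsD[OF part]
  define d where "d = sum_list ls"
  have n_pos: "0 < n" using n by simp
  have "real n ^ d * fact (n - d) \<le> exp (real d) * fact n"
    by (rule power_fact_diff_le) (simp add: p(1) d_def)
  then have "real n ^ d * fact l \<le> exp (real d) * fact n" using p(1) by (simp add: d_def)
  then have "ln (real n ^ d * fact l) \<le> ln (exp (real d) * fact n)"
    using n_pos by (subst ln_le_cancel_iff) auto
  then have 1: "real d * ln (real n) + ln (fact l) \<le> real d + ln (fact n)"
    using n_pos by (simp add: ln_mult ln_realpow)
  have 2: "ln (fact (ls ! i) :: real) \<le> real (ls ! i) * ln ((real (ls ! i) + 1) / 2)" for i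
  proof -
    have "ln (fact (ls ! i) :: real) \<le> ln (((real (ls ! i) + 1) / 2) ^ (ls ! i))"
      using fact_le_half_power[of "ls ! i"] by (subst ln_le_cancel_iff) auto
    then show ?thesis by (subst (asm) ln_realpow) auto
  qed
  have lnP: "ln (\<Prod>i<length ls. fact (ls ! i) :: real) = (\<Sum>i<length ls. ln (fact (ls ! i)))"
    by (subst ln_prod) auto
  have "ln (D_lam (l # ls) n) = ln (fact n) - ln (fact l * (\<Prod>i<length ls. fact (ls ! i)))"
    unfolding D_lam_Cons by (rule ln_divide_pos) (auto intro!: mult_pos_pos prod_pos)
  also have "ln (fact l * (\<Prod>i<length ls. fact (ls ! i) :: real))
    = ln (fact l) + (\<Sum>i<length ls. ln (fact (ls ! i)))"
    unfolding lnP[symmetric] by (rule ln_mult_pos) (auto intro!: prod_pos)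
  finally have lnD: "ln (D_lam (l # ls) n) = ln (fact n) - (ln (fact l) + (\<Sum>i<length ls. ln (fact (ls ! i))))" .
  have "real n * H'_ent (l # ls) n = (\<Sum>i<length ls. real (ls ! i) * ln (real n / real (ls ! i)))"
    using n_pos p(3) by (rule H'_ent_Cons)
  also have "\<dots> \<le> (\<Sum>i<length ls. real (ls ! i) * (4 * (ln (real n) - 1 - ln ((real (ls ! i) + 1) / 2))))"
    using n p(3,4) by (intro sum_mono mult_left_mono ln_part_le) auto
  also have "\<dots> = 4 * (real d * ln (real n) - real d - (\<Sum>i<length ls. real (ls ! i) * ln ((real (ls ! i) + 1) / 2)))"
    unfolding d_def real_sum_list_nth
    by (simp add: sum_distrib_left sum_distrib_right sum_subtractf sum.distrib algebra_simps)
  also have "\<dots> \<le> 4 * (real d * ln (real n) - real d - (\<Sum>i<length ls. ln (fact (ls ! i))))"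
    using 2 by (intro mult_left_mono diff_mono sum_mono) auto
  also have "\<dots> \<le> 4 * ln (D_lam (l # ls) n)" using 1 lnD by simp
  finally show ?thesis .
qed

text \<open>A part other than the largest is at most \<open>n/2\<close>, so its logarithm is at
  least \<open>ln 2\<close>, hence at least 1/2.\<close>

lemma H'_ent_ge:
  assumes part: "is_partition (l # ls) n" and n: "0 < n"
  shows "real (sum_list ls) \<le> 2 * (real n * H'_ent (l # ls) n)"
proof -
  note p = partition_ConsD[OF part]
  have "real (ls ! i) \<le> 2 * (real (ls ! i) * ln (real n / real (ls ! i)))" if i: "i < length ls" for i
  proof -
    have "1 / 2 \<le> ln (2::real)" using ln2_ge_two_thirds by simp
    also have "\<dots> \<le> ln (real n / real (ls ! i))"
      using p(3,4)[OF i] n by (subst ln_le_cancel_iff) (auto simp: field_simps)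
    finally have "real (ls ! i) * (1 / 2) \<le> real (ls ! i) * ln (real n / real (ls ! i))"
      by (rule mult_left_mono) simp
    then show ?thesis by linarith
  qed
  then have "real (sum_list ls) \<le> 2 * (\<Sum>i<length ls. real (ls ! i) * ln (real n / real (ls ! i)))"
    unfolding real_sum_list_nth sum_distrib_left by (intro sum_mono) auto
  also have "(\<Sum>i<length ls. real (ls ! i) * ln (real n / real (ls ! i))) = real n * H'_ent (l # ls) n"
    using n p(3) by (rule H'_ent_Cons[symmetric])
  finally show ?thesis .
qed

text \<open>The correction term of \<open>\<gamma>\<close> costs a factor \<open>(n / \<lambda>\<^sub>1)\<^bsup>\<lambda>\<^sub>1\<^esup>\<close>, up to a constant in the exponent.\<close>

lemma correction_ln_D_lam_ge:
  assumes part: "is_partition (l # ls) n" and ls: "ls \<noteq> []" and n: "40 \<le> n"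
  defines "\<theta> \<equiv> (H_ent (l # ls) n - H'_ent (l # ls) n) / H_ent (l # ls) n"
  shows "real l * ln (real n / real l) \<le> 12 * (\<theta> * ln (D_lam (l # ls) n))"
proof -
  note p = partition_ConsD[OF part]
  let ?H = "H_ent (l # ls) n" and ?H' = "H'_ent (l # ls) n" and ?L = "ln (D_lam (l # ls) n)"
  let ?W = "real l * ln (real n / real l)"
  have n_pos: "0 < n" using n by simp
  have W: "real n * (?H - ?H') = ?W" using p(2) n_pos by (rule H_ent_diff)
  have "0 < sum_list ls" using ls p(3)[of 0] elem_le_sum_list[of 0 ls] by fastforce
  then have "0 < real n * ?H'" using H'_ent_ge[OF part n_pos] by linarith
  then have H'_pos: "0 < ?H'" using n_pos by (simp only: zero_less_mult_iff) simp
  have W0: "0 \<le> ?W" using p(1,2) by simp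
  \<comment> \<open>The largest part's entropy term is at most \<open>d\<close>, thus at most
    \<open>2 n H'\<close>. So \<open>n H \<le> 3 n H'\<close>, and with the factor 4 of
    \<open>ln_D_lam_ge_H'\<close> this yields the constant 12.\<close>
  have "ln (real n / real l) \<le> real n / real l - 1" using p(1,2) by (intro ln_le_minus_one) auto
  then have "?W \<le> real l * (real n / real l - 1)" by (rule mult_left_mono) simp
  also have "\<dots> = real (sum_list ls)" using p(1,2) by (simp add: field_simps)
  also have "\<dots> \<le> 2 * (real n * ?H')" by (rule H'_ent_ge[OF part n_pos])
  finally have "real n * ?H \<le> 3 * (real n * ?H')" using W by (simp add: algebra_simps)
  then have nH: "real n * ?H \<le> 12 * ?L" using ln_D_lam_ge_H'[OF part n] by simp
  have "0 \<le> real n * (?H - ?H')" using W W0 by simp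
  then have "0 \<le> ?H - ?H'" using n_pos by (simp only: zero_le_mult_iff) simp
  then have H_pos: "0 < ?H" and \<theta>0: "0 \<le> \<theta>" using H'_pos by (auto simp: \<theta>_def)
  have "?W = \<theta> * (real n * ?H)" unfolding W[symmetric] \<theta>_def using H_pos by simp
  also have "\<dots> \<le> \<theta> * (12 * ?L)" using nH \<theta>0 by (rule mult_left_mono)
  finally show ?thesis by simp
qed

section \<open>The sparsity threshold\<close>

text \<open>Here \<open>1 - \<alpha>\<close> for the largest part is \<open>d/n\<close>. At
  \<open>d = 0\<close> both sides are 0 by the convention for division by zero.\<close>

lemma M_lam_Cons:
  assumes "is_partition (l # ls) n" "0 < n"
  shows "M_lam (l # ls) n = int (n div sum_list ls)"
proof -
  have "real (sum_list ls) = real n - real l" using partition_ConsD(1)[OF assms(1)] by simp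
  then have "1 - alpha (l # ls) n 0 = real (sum_list ls) / real n"
    using assms(2) by (simp add: alpha_def diff_divide_distrib)
  then have "M_lam (l # ls) n = \<lfloor>real n / real (sum_list ls)\<rfloor>" by (simp add: M_lam_def)
  then show ?thesis by (simp add: floor_divide_of_nat_eq)
qed

text \<open>Multiplying \<gamma> by \<open>M + 1\<close> leaves \<open>M (1 - c \<theta>)\<close>,
  so the power splits into \<open>D ^ M\<close> and a penalty from the correction term.\<close>

lemma sparsity_power_le:
  assumes part: "is_partition (l # ls) n" and n: "0 < n"
    and K: "real K \<le> 1 / 2 * D_lam (l # ls) n powr gamma_lam c (l # ls) n"
  defines "M \<equiv> n div sum_list ls" and "D \<equiv> D_lam (l # ls) n"
    and "\<theta> \<equiv> (H_ent (l # ls) n - H'_ent (l # ls) n) / H_ent (l # ls) n"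
  shows "real K ^ (M + 1) \<le> D ^ M * exp (- (c * real M * (\<theta> * ln D)))"
proof -
  let ?g = "gamma_lam c (l # ls) n"
  have D: "0 < D" unfolding D_def D_lam_Cons by (simp add: prod_pos)
  have g: "?g * (real M + 1) = real M - c * real M * \<theta>"
    unfolding gamma_lam_def M_lam_Cons[OF part n] M_def[symmetric] \<theta>_def by (simp add: field_simps)
  have "0 \<le> D powr ?g" by simp
  then have "real K \<le> D powr ?g" using K unfolding D_def[symmetric] by linarith
  then have "real K ^ (M + 1) \<le> (D powr ?g) ^ (M + 1)" by (intro power_mono) auto
  also have "\<dots> = (D powr ?g) powr real (M + 1)" using D by (intro powr_realpow[symmetric]) simp
  also have "\<dots> = D powr (?g * real (M + 1))" by (rule powr_powr)
  also have "\<dots> = D powr (real M - c * real M * \<theta>)" using g by (simp add: add.commute)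
  also have "\<dots> = D powr real M * D powr (- (c * real M * \<theta>))" by (simp flip: powr_add)
  also have "D powr (- (c * real M * \<theta>)) = exp (- (c * real M * (\<theta> * ln D)))"
    using D by (simp add: powr_def mult_ac)
  finally show ?thesis using D by (simp add: powr_realpow)
qed

text \<open>For the case \<open>M = 1\<close>, where the correction alone must supply the decay.
  Write \<open>ln n\<close> as \<open>ln (n/l) + ln l\<close> and bound both summands by multiples
  of \<open>l * ln (n/l)\<close>.\<close>

lemma mult_ln_div_ge:
  assumes l: "0 < l" "2 * l \<le> n"
  shows "ln (real n) \<le> 3 * (real l * ln (real n / real l))"
proof -
  let ?y = "ln (real n / real l)"
  have "1 / 2 \<le> ln (2::real)" using ln2_ge_two_thirds by simp
  also have "\<dots> \<le> ?y" using l by (subst ln_le_cancel_iff) (auto simp: field_simps)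
  finally have y: "1 / 2 \<le> ?y" .
  have "ln (real n) = ?y + ln (real l)" using l by (simp add: ln_div)
  moreover have "ln (real l) \<le> real l" using l by (simp add: ln_bound)
  moreover have "real l * (1 / 2) \<le> real l * ?y" using y by (rule mult_left_mono) simp
  moreover have "1 * ?y \<le> real l * ?y" using l y by (intro mult_right_mono) auto
  ultimately show ?thesis by linarith
qed

text \<open>For \<open>M = 1\<close> the exact rate \<open>1 / D\<close> works and the penalty gives
  \<open>1 / n\<close>. For \<open>M \<ge> 2\<close> one rate must serve all \<open>J\<close>, which
  costs at most \<open>exp n\<close> in total, and the penalty outweighs it.\<close>

lemma sparsity_bound:
  assumes part: "is_partition (l # ls) n" and ls: "ls \<noteq> []" and n: "40 \<le> n"
    and K: "real K \<le> 1 / 2 * D_lam (l # ls) n powr gamma_lam 96 (l # ls) n"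
  defines "M \<equiv> n div sum_list ls"
  shows "\<exists>\<rho>\<ge>0. real K ^ (M + 1) * \<rho> ^ M \<le> 1 / real n \<and> (\<forall>J\<subseteq>{..<M}.
    real (card {\<pi> \<in> Sn n. \<forall>m\<in>J. act \<pi> (window_part ls n m) = window_part ls n m})
      \<le> \<rho> ^ card J * fact n)"
proof -
  note p = partition_ConsD[OF part]
  define d where "d = sum_list ls"
  define P where "P = (\<Prod>i<length ls. fact (ls ! i) :: real)"
  define D where "D = D_lam (l # ls) n"
  define G where "G = (H_ent (l # ls) n - H'_ent (l # ls) n) / H_ent (l # ls) n * ln D"
  let ?W = "real l * ln (real n / real l)"
  let ?c = "\<lambda>J. card {\<pi> \<in> Sn n. \<forall>m\<in>J. act \<pi> (window_part ls n m) = window_part ls n m}"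
  have n_pos: "0 < n" using n by simp
  have d_pos: "0 < d" unfolding d_def using ls p(3)[of 0] elem_le_sum_list[of 0 ls] by fastforce
  have nl: "n - d = l" "d \<le> n" using p(1) by (auto simp: d_def)
  have Md: "M * d \<le> n" by (simp add: M_def d_def)
  have Md': "n < M * d + d" using d_pos dividend_less_div_times[of d n] by (simp add: M_def d_def)
  have P: "0 < P" unfolding P_def by (simp add: prod_pos)
  have D_eq: "D = fact n / (fact l * P)" by (simp add: D_def D_lam_Cons P_def)
  have D: "0 < D" using P by (simp add: D_eq)
  have W: "?W \<le> 12 * G" unfolding G_def D_def by (rule correction_ln_D_lam_ge[OF part ls n])
  have KM: "real K ^ (M + 1) \<le> D ^ M * exp (- (96 * real M * G))"
    unfolding M_def D_def G_def by (rule sparsity_power_le[OF part n_pos K])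
  have card_le: "real (?c J) \<le> P ^ card J * fact (n - card J * d)" if J: "J \<subseteq> {..<M}" for J
  proof -
    have "M * sum_list ls \<le> n" using Md by (simp add: d_def)
    from card_window_stabiliser_le[OF J this]
    have "real (?c J) \<le> real ((\<Prod>i<length ls. fact (ls ! i)) ^ card J * fact (n - card J * sum_list ls))"
      by (rule of_nat_mono)
    then show ?thesis by (simp add: P_def d_def)
  qed
  have "M \<noteq> 0" using Md' nl(2) d_pos by (cases "M = 0") (use p(1,2) in \<open>auto simp: d_def\<close>)
  then consider "M = 1" | "2 \<le> M" by linarith
  then show ?thesis
  proof cases
    case 1
    have "real K ^ (M + 1) * (1 / D) ^ M \<le> exp (- (96 * G))"
      using KM D by (simp add: 1 field_simps)
    also have "\<dots> \<le> exp (- ln (real n))"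
    proof -
      \<comment> \<open>\<open>M = 1\<close> means \<open>n < 2 d\<close>, so the largest part is
        less than half of \<open>n\<close>.\<close>
      have "2 * l \<le> n" using Md' p(1) 1 by (simp add: d_def)
      then have "ln (real n) \<le> 3 * ?W" using p(2) by (intro mult_ln_div_ge)
      moreover have "0 \<le> ln (real n)" using n_pos by simp
      ultimately show ?thesis using W by simp
    qed
    also have "\<dots> = 1 / real n" using n_pos by (simp add: exp_minus divide_inverse)
    finally have bound: "real K ^ (M + 1) * (1 / D) ^ M \<le> 1 / real n" .
    have "real (?c J) \<le> (1 / D) ^ card J * fact n" if J: "J \<subseteq> {..<M}" for J
    proof -
      have "J = {} \<or> J = {0}" using J 1 by auto
      then have "P ^ card J * fact (n - card J * d) = (1 / D) ^ card J * fact n"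
        using nl P by (auto simp: D_eq field_simps)
      then show ?thesis using card_le[OF J] by simp
    qed
    then show ?thesis using bound D by (intro exI[of _ "1 / D"]) auto
  next
    case 2
    \<comment> \<open>By \<open>power_fact_diff_le\<close>, fixing \<open>|J| d\<close> points'
      worth of windows replaces \<open>fact n\<close> by at most \<open>(e/n)^(|J| d)\<close> times
      \<open>fact n\<close>; \<open>\<rho>\<close> is the contribution of a single window.\<close>
    define \<rho> where "\<rho> = P * exp (real d) / real n ^ d"
    have \<rho>: "0 \<le> \<rho>" using P by (simp add: \<rho>_def)
    have "(fact n :: real) \<le> real n ^ d * fact l" using fact_le_power_fact_diff[OF nl(2)] nl(1) by simp
    then have "D * \<rho> \<le> exp (real d)" using P n_pos by (simp add: D_eq \<rho>_def field_simps)
    then have "(D * \<rho>) ^ M \<le> exp (real d) ^ M" using D \<rho> by (intro power_mono) auto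
    also have "\<dots> = exp (real (M * d))" by (simp add: exp_of_nat_mult)
    also have "\<dots> \<le> exp (real n)" using Md by (simp only: exp_le_cancel_iff of_nat_le_iff)
    finally have D\<rho>: "(D * \<rho>) ^ M \<le> exp (real n)" .
    have "2 * d \<le> M * d" using 2 by (rule mult_le_mono1)
    then have dn: "2 * d \<le> n" using Md by linarith
    have "real d \<le> 2 * ?W"
    proof -
      \<comment> \<open>This bounds the entropy term below by \<open>l d / n\<close>, which is at
        least \<open>d/2\<close> because \<open>M \<ge> 2\<close> makes the largest part at least
        \<open>n/2\<close>.\<close>
      have "ln (real l / real n) \<le> real l / real n - 1" using p(2) n_pos by (intro ln_le_minus_one) auto
      then have "1 - real l / real n \<le> ln (real n / real l)" using p(2) n_pos by (simp add: ln_div)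
      moreover have "real d = real n - real l" using p(1) by (simp add: d_def)
      then have "1 - real l / real n = real d / real n" using n_pos by (simp add: diff_divide_distrib)
      ultimately have "real l * (real d / real n) \<le> ?W" by (intro mult_left_mono) auto
      moreover have "real d \<le> 2 * (real l * (real d / real n))"
      proof -
        have "real n \<le> 2 * real l" using dn nl by linarith
        then have "real d * real n \<le> real d * (2 * real l)" by (rule mult_left_mono) simp
        then show ?thesis using n_pos by (simp add: field_simps)
      qed
      ultimately show ?thesis by linarith
    qed
    then have "real M * real d \<le> real M * (24 * G)" using W by (intro mult_left_mono) auto
    moreover have "real n \<le> 2 * (real M * real d)"
    proof -
      have "n \<le> 2 * (M * d)" using Md' dn by linarith
      then show ?thesis by (metis of_nat_le_iff of_nat_mult of_nat_numeral)
    qed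
    \<comment> \<open>Origin of 96: a factor 12 from \<open>?W \<le> 12 * G\<close>, 2 from
      \<open>d \<le> 2 * ?W\<close>, 2 from \<open>n \<le> 2 M d\<close>, and 2 because a penalty of
      \<open>exp (- 2 n)\<close> is wanted against the excess \<open>exp n\<close>.\<close>
    ultimately have "2 * real n \<le> 4 * (real M * (24 * G))" by linarith
    then have G: "2 * real n \<le> 96 * real M * G" by (simp add: mult_ac)
    have "real K ^ (M + 1) * \<rho> ^ M \<le> D ^ M * exp (- (96 * real M * G)) * \<rho> ^ M"
      using KM \<rho> by (intro mult_right_mono) auto
    also have "\<dots> = (D * \<rho>) ^ M * exp (- (96 * real M * G))" by (simp add: power_mult_distrib mult_ac)
    also have "\<dots> \<le> exp (real n) * exp (- (2 * real n))" using D\<rho> G by (intro mult_mono) auto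
    also have "\<dots> = 1 / exp (real n)" by (simp add: exp_minus[symmetric] divide_inverse flip: exp_add)
    also have "\<dots> \<le> 1 / real n"
    proof -
      have "real n \<le> exp (real n)" using exp_ge_add_one_self[of "real n"] by linarith
      then show ?thesis using n_pos by (intro divide_left_mono) auto
    qed
    finally have bound: "real K ^ (M + 1) * \<rho> ^ M \<le> 1 / real n" .
    have "real (?c J) \<le> \<rho> ^ card J * fact n" if J: "J \<subseteq> {..<M}" for J
    proof -
      have "card J \<le> M" using card_mono[OF _ J] by simp
      then have "card J * d \<le> n" using Md mult_le_mono1[of "card J" M d] by linarith
      then have "real n ^ (card J * d) * fact (n - card J * d) \<le> exp (real (card J * d)) * fact n"
        by (rule power_fact_diff_le)
      moreover have "real n ^ (card J * d) = (real n ^ d) ^ card J" by (metis power_mult mult.commute)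
      moreover have "exp (real (card J * d)) = exp (real d) ^ card J" by (simp add: exp_of_nat_mult)
      ultimately have "(real n ^ d) ^ card J * fact (n - card J * d) \<le> exp (real d) ^ card J * fact n"
        by simp
      then have "fact (n - card J * d) \<le> exp (real d) ^ card J / (real n ^ d) ^ card J * fact n"
        using n_pos by (simp add: pos_le_divide_eq mult.commute)
      then have "P ^ card J * fact (n - card J * d)
        \<le> P ^ card J * (exp (real d) ^ card J / (real n ^ d) ^ card J * fact n)"
        using P by (intro mult_left_mono) auto
      also have "\<dots> = \<rho> ^ card J * fact n" by (simp add: \<rho>_def power_mult_distrib power_divide)
      finally show ?thesis using card_le[OF J] by linarith
    qed
    then show ?thesis using bound \<rho> by (intro exI[of _ \<rho>]) auto
  qed
qed

section \<open>Recovery\<close>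

text \<open>The failure event is covered by a measurable set: outcomes with an unwitnessed sample,
  together with a null set of non-generic outcomes.\<close>

lemma recovery_failure_le:
  assumes a: "0 < a" and ab: "a < b" and n: "40 \<le> n" and part: "is_partition lam n"
    and K: "real K \<le> 1 / 2 * D_lam lam n powr gamma_lam 96 lam n"
  shows "\<exists>E\<in>sets (model_R n K a b).
    {\<omega> \<in> space (model_R n K a b). \<not> sparsest_fit_recovers lam n (model_f K \<omega>)} \<subseteq> E \<and>
    measure (model_R n K a b) E \<le> 1 / real n"
proof -
  let ?R = "model_R n K a b"
  obtain l ls where lam: "lam = l # ls"
    using part n by (cases lam) (auto simp: is_partition_def)
  note part' = part[unfolded lam]
  show ?thesis
  proof (cases "ls = []")
    case True
    have "D_lam lam n = 1" using part' True by (simp add: lam D_lam_Cons is_partition_def)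
    \<comment> \<open>With a single block \<open>D = 1\<close>, so the constant 1/2 forces
      \<open>K < 1\<close>; otherwise distinct permutations could not be told apart.\<close>
    then have "K = 0" using K by simp
    then have "sparsest_fit_recovers lam n (model_f K \<omega>)" for \<omega>
      by (intro sparsest_fit_recovers_if_witnessed) (auto simp: inj_on_def)
    then show ?thesis using n by (intro bexI[of _ "{}"]) auto
  next
    case ls: False
    define M where "M = n div sum_list ls"
    let ?T = "window_part ls n"
    obtain \<rho> where \<rho>: "0 \<le> \<rho>" "real K ^ (M + 1) * \<rho> ^ M \<le> 1 / real n"
      and stab: "\<And>J. J \<subseteq> {..<M} \<Longrightarrow>
        real (card {\<pi> \<in> Sn n. \<forall>m\<in>J. act \<pi> (?T m) = ?T m}) \<le> \<rho> ^ card J * fact n"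
      using sparsity_bound[OF part' ls n K[unfolded lam]] unfolding M_def by blast
    have "\<exists>E\<in>sets ?R. measure ?R E \<le> real K ^ (M + 1) * \<rho> ^ M \<and>
      (\<forall>\<omega>\<in>space ?R - E. (\<forall>i<K. fst (\<omega> i) \<in> Sn n) \<longrightarrow>
        (\<forall>i<K. \<exists>m<M. \<forall>j<K. j \<noteq> i \<longrightarrow> act (fst (\<omega> j)) (?T m) \<noteq> act (fst (\<omega> i)) (?T m)))"
      using ab stab \<rho>(1) by (rule unwitnessed_measure_le)
    then obtain E where E: "E \<in> sets ?R" "measure ?R E \<le> real K ^ (M + 1) * \<rho> ^ M"
      and wit: "\<forall>\<omega>\<in>space ?R - E. (\<forall>i<K. fst (\<omega> i) \<in> Sn n) \<longrightarrow>
        (\<forall>i<K. \<exists>m<M. \<forall>j<K. j \<noteq> i \<longrightarrow> act (fst (\<omega> j)) (?T m) \<noteq> act (fst (\<omega> i)) (?T m))"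
      by (elim bexE conjE)
    define generic where "generic \<omega> \<longleftrightarrow> (\<forall>i<K. fst (\<omega> i) \<in> Sn n) \<and> (\<forall>i<K. 0 < snd (\<omega> i)) \<and>
      inj_on (sum (\<lambda>i. snd (\<omega> i))) (Pow {..<K})" for \<omega> :: "nat \<Rightarrow> (nat \<Rightarrow> nat) \<times> real"
    have "AE \<omega> in ?R. generic \<omega>" unfolding generic_def by (rule AE_model_R_generic[OF a ab])
    then obtain N where N: "N \<in> null_sets ?R" and "{\<omega> \<in> space ?R. \<not> generic \<omega>} \<subseteq> N"
      unfolding eventually_ae_filter by blast
    then have gen: "generic \<omega>" if "\<omega> \<in> space ?R - N" for \<omega> using that by blast
    have "sparsest_fit_recovers lam n (model_f K \<omega>)" if \<omega>: "\<omega> \<in> space ?R - (E \<union> N)" for \<omega>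
    proof (rule sparsest_fit_recovers_if_witnessed)
      have "\<omega> \<in> space ?R - N" using \<omega> by blast
      note g = gen[OF this, unfolded generic_def]
      show Sn: "fst (\<omega> i) \<in> Sn n" and "0 < snd (\<omega> i)" if "i < K" for i using g that by auto
      show "inj_on (sum (\<lambda>i. snd (\<omega> i))) (Pow {..<K})" using g by blast
      show "\<tau> = fst (\<omega> i)"
        if "i < K" "\<tau> \<in> Sn n" "supp_M lam n \<tau> = supp_M lam n (fst (\<omega> i))" for i \<tau>
        using supp_M_inj[OF part' ls Sn[OF that(1)] that(2)] that(3) by (simp add: lam)
      show "\<exists>x. {j\<in>{..<K}. x \<in> supp_M lam n (fst (\<omega> j))} = {i}" if i: "i < K" for i
      proof -
        have "\<omega> \<in> space ?R - E" using \<omega> by blast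
        with wit g i have "\<exists>m<M. \<forall>j<K. j \<noteq> i \<longrightarrow> act (fst (\<omega> j)) (?T m) \<noteq> act (fst (\<omega> i)) (?T m)" by simp
        then obtain m where m: "m < M"
          and dist: "\<And>j. j < K \<Longrightarrow> j \<noteq> i \<Longrightarrow> act (fst (\<omega> j)) (?T m) \<noteq> act (fst (\<omega> i)) (?T m)" by blast
        have "Suc m * sum_list ls \<le> M * sum_list ls" using m by (intro mult_le_mono1) simp
        also have "\<dots> \<le> n" by (simp add: M_def)
        finally have T: "?T m \<in> lam_parts lam n" unfolding lam by (rule window_part_mem[OF part'])
        \<comment> \<open>The column is the test partition that separates sample \<open>i\<close>,
          the row its image; only sample \<open>i\<close> has a 1 there.\<close>
        let ?x = "(act (fst (\<omega> i)) (?T m), ?T m)"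
        have "?x \<in> supp_M lam n (fst (\<omega> j)) \<longleftrightarrow> j = i" if "j < K" for j
          using mem_supp_M_iff[OF Sn[OF that], of ?x lam] T dist[OF that]
          by (cases "j = i") (auto dest: sym)
        then have "{j\<in>{..<K}. ?x \<in> supp_M lam n (fst (\<omega> j))} = {i}" using i by auto
        then show ?thesis by blast
      qed
    qed
    then have "{\<omega> \<in> space ?R. \<not> sparsest_fit_recovers lam n (model_f K \<omega>)} \<subseteq> E \<union> N" by blast
    moreover have "measure ?R (E \<union> N) \<le> 1 / real n"
      using E \<rho>(2) measure_Un_null_set[OF E(1) N] by linarith
    ultimately show ?thesis using E(1) N by (intro bexI[of _ "E \<union> N"]) auto
  qed
qed

theorem theorem6:
  shows "\<exists>C C'. 0 < C \<and> 0 < C' \<and>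
    (\<forall>a b lamseq Kseq. 0 < a \<and> a < b
       \<and> (\<forall>n. is_partition (lamseq n) n)
       \<and> (\<forall>n. real (Kseq n) \<le> C * D_lam (lamseq n) n powr gamma_lam C' (lamseq n) n)
     \<longrightarrow> (\<forall>\<epsilon>>0. eventually (\<lambda>n. \<exists>E\<in>sets (model_R n (Kseq n) a b).
              {\<omega> \<in> space (model_R n (Kseq n) a b).
                 \<not> sparsest_fit_recovers (lamseq n) n (model_f (Kseq n) \<omega>)} \<subseteq> E
              \<and> measure (model_R n (Kseq n) a b) E \<le> \<epsilon>) sequentially))"
proof (rule exI[of _ "1 / 2"], rule exI[of _ 96], intro conjI allI impI)
  fix a b \<epsilon> :: real and lamseq Kseq
  assume *: "0 < a \<and> a < b \<and> (\<forall>n. is_partition (lamseq n) n)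
       \<and> (\<forall>n. real (Kseq n) \<le> 1 / 2 * D_lam (lamseq n) n powr gamma_lam 96 (lamseq n) n)"
    and \<epsilon>: "0 < \<epsilon>"
  obtain N where N: "1 / \<epsilon> < real N" using reals_Archimedean2 by blast
  show "eventually (\<lambda>n. \<exists>E\<in>sets (model_R n (Kseq n) a b).
      {\<omega> \<in> space (model_R n (Kseq n) a b).
         \<not> sparsest_fit_recovers (lamseq n) n (model_f (Kseq n) \<omega>)} \<subseteq> E
      \<and> measure (model_R n (Kseq n) a b) E \<le> \<epsilon>) sequentially"
    \<comment> \<open>The bound 40 is required by \<open>recovery_failure_le\<close>, and
      \<open>N\<close> makes \<open>1 / n\<close> at most \<open>\<epsilon>\<close>.\<close>
    using eventually_ge_at_top[of "max 40 N"]
  proof eventually_elim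
    case (elim n)
    then have "1 / \<epsilon> \<le> real n" "0 < real n" using N by auto
    then have "1 / real n \<le> \<epsilon>" using \<epsilon> by (simp add: field_simps)
    moreover obtain E where "E \<in> sets (model_R n (Kseq n) a b)"
      "{\<omega> \<in> space (model_R n (Kseq n) a b).
         \<not> sparsest_fit_recovers (lamseq n) n (model_f (Kseq n) \<omega>)} \<subseteq> E"
      "measure (model_R n (Kseq n) a b) E \<le> 1 / real n"
      using recovery_failure_le[of a b n "lamseq n" "Kseq n"] * elim by auto
    ultimately show ?case by (intro bexI[of _ E]) auto
  qed
qed simp_all

end
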